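(* Let $\Omega\subseteq\mathbb{R}^N$ ($N\ge 2$) be a bounded domain, let $\mathcal{L}=\sum_{i,j=1}^N\partial_i(b_{ij}(x)\partial_j)$ be uniformly $X$-elliptic in $\Omega$ with respect to a family $X=\{X_1,\dots,X_m\}$ of vector fields, and assume the Sobolev-type embedding property (S). Let $a\in L^1(\Omega)$ with $a\ge 0$, let $f\in L^1(\Omega)$, and let $g\colon\mathbb{R}\to\mathbb{R}$ be continuous, odd and (strictly) increasing. Assume that there exists $Q\in\left(0,\lim_{s\to+\infty}g(s)\right)$ such that $|f(x)|\le Q\,a(x)$ for a.e. $x\in\Omega$. Then there exists a unique weak solution $u\in\mathscr{H}_X(\Omega)\cap L^\infty(\Omega)$ of $$-\mathcal{L}u+a(x)g(u)=f(x)\ \text{ in }\Omega,\qquad u=0\ \text{ on }\partial\Omega.$$ Moreover, $$\|u\|_{L^\infty(\Omega)}\le g^{-1}(Q).$$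
   Context: **Vector fields and operator.** $X=\{X_1,\dots,X_m\}$ is a family of vector fields $X_j=(c_{j1},\dots,c_{jN})$ on $\mathbb{R}^N$ with $c_{jk}$ locally Lipschitz continuous on $\mathbb{R}^N$; $X_j$ is identified with the operator $X_j=\sum_{k=1}^N c_{jk}\partial_k$, and $Xu=(X_1u,\dots,X_mu)$ is the $X$-gradient. The coefficients $b_{ij}=b_{ji}$ are measurable functions on $\mathbb{R}^N$, and $B(x)=(b_{ij}(x))$. The operator $\mathcal{L}$ is uniformly $X$-elliptic in $\Omega$ if there is a constant $\Lambda>0$ such that $$\frac1\Lambda\sum_{j=1}^m\langle X_j(x),\xi\rangle^2\le\sum_{i,j=1}^N b_{ij}(x)\xi_i\xi_j\le\Lambda\sum_{j=1}^m\langle X_j(x),\xi\rangle^2\qquad\text{for all }\xi\in\mathbb{R}^N,\ x\in\Omega,$$ where $\langle X_j(x),\xi\rangle=\sum_{k=1}^N c_{jk}(x)\xi_k$. **Function space.** $u\mapsto\|u\|_X:=\|Xu\|_{L^2(\Omega)}$ is a norm on $C^1_0(\Omega)$, and $\mathscr{H}_X(\Omega)$ is the Hilbert space obtained as the completion of $C^1_0(\Omega)$ with respect to this norm, with scalar product $\langle u,v\rangle_X=\int_\Omega Xu\cdot Xv$. **Assumption (S).** There exists a number $2^*_X=2^*_X(\Omega)>2$ such that the embedding $\mathscr{H}_X(\Omega)\hookrightarrow L^p(\Omega)$ is continuous for $p\in[1,2^*_X]$ and compact for every $p\in[1,2^*_X)$. Elements of $\mathscr{H}_X(\Omega)$ are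 accordingly regarded as functions on $\Omega$. **Bilinear form.** By $X$-ellipticity, $\left|\int_\Omega B(x)\nabla u\cdot\nabla v\right|\le\Lambda\|u\|_X\|v\|_X$ for $u,v\in C^1_0(\Omega)$, so $(u,v)\mapsto\int_\Omega B(x)\nabla u\cdot\nabla v$ extends continuously to $\mathscr{H}_X(\Omega)\times\mathscr{H}_X(\Omega)$; the same notation is used for the extension. **Weak solution.** $u\in\mathscr{H}_X(\Omega)$ is a weak solution of the problem if $a\,g(u)\in L^1(\Omega)$ and $$\int_\Omega B(x)\nabla u\cdot\nabla v+\int_\Omega a(x)g(u)v=\int_\Omega f(x)v\qquad\text{for all }v\in\mathscr{H}_X(\Omega)\cap L^\infty(\Omega).$$ **Inverse.** Since $g$ is continuous, odd and strictly increasing, it has an inverse $g^{-1}$ defined on $\left(-\lim_{s\to+\infty}g(s),\lim_{s\to+\infty}g(s)\right)$, where the limit belongs to $(0,+\infty]$. *)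

theory Defs
  imports "HOL-Analysis.Analysis" "HOL-Probability.Essential_Supremum"
begin

definition in_Lp :: "(real^'n) set \<Rightarrow> real \<Rightarrow> (real^'n \<Rightarrow> real) \<Rightarrow> bool" where
  "in_Lp \<Omega> p u \<longleftrightarrow>
     u \<in> borel_measurable (lebesgue_on \<Omega>) \<and>
     integrable (lebesgue_on \<Omega>) (\<lambda>x. \<bar>u x\<bar> powr p)"

definition Lp_norm :: "(real^'n) set \<Rightarrow> real \<Rightarrow> (real^'n \<Rightarrow> real) \<Rightarrow> real" where
  "Lp_norm \<Omega> p u = (LINT x|lebesgue_on \<Omega>. \<bar>u x\<bar> powr p) powr (1 / p)"

definition Linf_norm :: "(real^'n) set \<Rightarrow> (real^'n \<Rightarrow> real) \<Rightarrow> ereal" where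
  "Linf_norm \<Omega> u = esssup (lebesgue_on \<Omega>) (\<lambda>x. ereal \<bar>u x\<bar>)"

definition in_Linf :: "(real^'n) set \<Rightarrow> (real^'n \<Rightarrow> real) \<Rightarrow> bool" where
  "in_Linf \<Omega> u \<longleftrightarrow> u \<in> borel_measurable (lebesgue_on \<Omega>) \<and> Linf_norm \<Omega> u < \<infinity>"

definition locally_lipschitz :: "('a::metric_space \<Rightarrow> 'b::metric_space) \<Rightarrow> bool" where
  "locally_lipschitz c \<longleftrightarrow> (\<forall>x. \<exists>r>0. \<exists>L. L-lipschitz_on (ball x r) c)"

definition grad :: "(real^'n \<Rightarrow> real) \<Rightarrow> real^'n \<Rightarrow> real^'n" where
  "grad \<phi> x = (\<chi> k. frechet_derivative \<phi> (at x) (axis k 1))"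

text \<open>Functions in \<open>C1_0 \<Omega>\<close> are defined on the whole space, being extended by zero
  outside their compact support in \<open>\<Omega>\<close>.\<close>

definition C1_0 :: "(real^'n) set \<Rightarrow> (real^'n \<Rightarrow> real) set" where
  "C1_0 \<Omega> = {\<phi>. (\<forall>x. \<phi> differentiable (at x)) \<and> continuous_on UNIV (grad \<phi>) \<and>
     compact (closure {x. \<phi> x \<noteq> 0}) \<and> closure {x. \<phi> x \<noteq> 0} \<subseteq> \<Omega>}"

text \<open>A family of vector fields is a function \<open>X\<close> with \<open>X j x $ k = c\<^sub>j\<^sub>k(x)\<close>.\<close>

definition X_grad ::
    "('m \<Rightarrow> real^'n \<Rightarrow> real^'n) \<Rightarrow> (real^'n \<Rightarrow> real) \<Rightarrow> real^'n \<Rightarrow> real^'m" where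
  "X_grad X \<phi> x = (\<chi> j. \<Sum>k\<in>UNIV. X j x $ k * grad \<phi> x $ k)"

definition X_elliptic ::
    "(real^'n) set \<Rightarrow> ('m::finite \<Rightarrow> real^'n \<Rightarrow> real^'n) \<Rightarrow> (real^'n \<Rightarrow> real^'n^'n) \<Rightarrow> bool" where
  "X_elliptic \<Omega> X B \<longleftrightarrow>
     (\<exists>\<Lambda>>0. \<forall>x\<in>\<Omega>. \<forall>\<xi>.
        1 / \<Lambda> * (\<Sum>j\<in>UNIV. (X j x \<bullet> \<xi>)\<^sup>2)
          \<le> (\<Sum>i\<in>UNIV. \<Sum>j\<in>UNIV. B x $ i $ j * \<xi> $ i * \<xi> $ j) \<and>
        (\<Sum>i\<in>UNIV. \<Sum>j\<in>UNIV. B x $ i $ j * \<xi> $ i * \<xi> $ j)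
          \<le> \<Lambda> * (\<Sum>j\<in>UNIV. (X j x \<bullet> \<xi>)\<^sup>2))"

definition X_inner ::
    "(real^'n) set \<Rightarrow> ('m::finite \<Rightarrow> real^'n \<Rightarrow> real^'n) \<Rightarrow>
     (real^'n \<Rightarrow> real) \<Rightarrow> (real^'n \<Rightarrow> real) \<Rightarrow> real" where
  "X_inner \<Omega> X \<phi> \<psi> = (LINT x|lebesgue_on \<Omega>. X_grad X \<phi> x \<bullet> X_grad X \<psi> x)"

definition X_norm ::
    "(real^'n) set \<Rightarrow> ('m::finite \<Rightarrow> real^'n \<Rightarrow> real^'n) \<Rightarrow> (real^'n \<Rightarrow> real) \<Rightarrow> real" where
  "X_norm \<Omega> X \<phi> = sqrt (X_inner \<Omega> X \<phi> \<phi>)"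

definition X_Cauchy ::
    "(real^'n) set \<Rightarrow> ('m::finite \<Rightarrow> real^'n \<Rightarrow> real^'n) \<Rightarrow> (nat \<Rightarrow> real^'n \<Rightarrow> real) \<Rightarrow> bool" where
  "X_Cauchy \<Omega> X \<Phi> \<longleftrightarrow>
     (\<forall>n. \<Phi> n \<in> C1_0 \<Omega>) \<and>
     (\<forall>e>0. \<exists>M. \<forall>m\<ge>M. \<forall>n\<ge>M. X_norm \<Omega> X (\<lambda>x. \<Phi> m x - \<Phi> n x) < e)"

text \<open>The completion of \<open>C1_0 \<Omega>\<close> under \<open>X_norm\<close>: its elements are equivalence classes of
  Cauchy sequences, whose difference tends to zero.\<close>

type_synonym 'n hx = "(nat \<Rightarrow> real^'n \<Rightarrow> real) set"

definition HX :: "(real^'n) set \<Rightarrow> ('m::finite \<Rightarrow> real^'n \<Rightarrow> real^'n) \<Rightarrow> 'n hx set" where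
  "HX \<Omega> X = {\<Phi>. X_Cauchy \<Omega> X \<Phi>} //
     {(\<Phi>, \<Psi>). X_Cauchy \<Omega> X \<Phi> \<and> X_Cauchy \<Omega> X \<Psi> \<and>
        (\<lambda>n. X_norm \<Omega> X (\<lambda>x. \<Phi> n x - \<Psi> n x)) \<longlonglongrightarrow> 0}"

text \<open>Extension by continuity, from \<open>C1_0 \<Omega>\<close> to its completion, of a bilinear form that is
  bounded with respect to \<open>X_norm\<close>.\<close>

definition bilinear_extension ::
    "((real^'n \<Rightarrow> real) \<Rightarrow> (real^'n \<Rightarrow> real) \<Rightarrow> real) \<Rightarrow> 'n hx \<Rightarrow> 'n hx \<Rightarrow> real" where
  "bilinear_extension F U V =
     (THE l. \<forall>\<Phi>\<in>U. \<forall>\<Psi>\<in>V. (\<lambda>n. F (\<Phi> n) (\<Psi> n)) \<longlonglongrightarrow> l)"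

definition HX_inner ::
    "(real^'n) set \<Rightarrow> ('m::finite \<Rightarrow> real^'n \<Rightarrow> real^'n) \<Rightarrow> 'n hx \<Rightarrow> 'n hx \<Rightarrow> real" where
  "HX_inner \<Omega> X = bilinear_extension (X_inner \<Omega> X)"

definition HX_norm ::
    "(real^'n) set \<Rightarrow> ('m::finite \<Rightarrow> real^'n \<Rightarrow> real^'n) \<Rightarrow> 'n hx \<Rightarrow> real" where
  "HX_norm \<Omega> X U = sqrt (HX_inner \<Omega> X U U)"

definition L_form ::
    "(real^'n) set \<Rightarrow> (real^'n \<Rightarrow> real^'n^'n) \<Rightarrow> 'n hx \<Rightarrow> 'n hx \<Rightarrow> real" where
  "L_form \<Omega> B =
     bilinear_extension (\<lambda>\<phi> \<psi>. LINT x|lebesgue_on \<Omega>. (B x *v grad \<phi> x) \<bullet> grad \<psi> x)"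

text \<open>\<open>u\<close> is the function on \<open>\<Omega>\<close> identified with the element \<open>U\<close> of the completion: the
  common limit in \<open>L\<^sup>1(\<Omega>)\<close> of the sequences in \<open>U\<close>. It is determined only up to null sets;
  \<open>fun_of \<Omega> U\<close> chooses a representative.\<close>

definition represents :: "(real^'n) set \<Rightarrow> 'n hx \<Rightarrow> (real^'n \<Rightarrow> real) \<Rightarrow> bool" where
  "represents \<Omega> U u \<longleftrightarrow>
     in_Lp \<Omega> 1 u \<and> (\<forall>\<Phi>\<in>U. (\<lambda>n. Lp_norm \<Omega> 1 (\<lambda>x. \<Phi> n x - u x)) \<longlonglongrightarrow> 0)"

definition fun_of :: "(real^'n) set \<Rightarrow> 'n hx \<Rightarrow> real^'n \<Rightarrow> real" where
  "fun_of \<Omega> U = (SOME u. represents \<Omega> U u)"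

text \<open>The first two conditions say that \<open>fun_of\<close> is well defined on the completion and
  injective modulo null sets; they are what allows its elements to be regarded as functions.
  Since \<open>fun_of\<close> is linear modulo null sets, boundedness expresses continuity.\<close>

definition assumption_S ::
    "(real^'n) set \<Rightarrow> ('m::finite \<Rightarrow> real^'n \<Rightarrow> real^'n) \<Rightarrow> bool" where
  "assumption_S \<Omega> X \<longleftrightarrow>
     (\<forall>U\<in>HX \<Omega> X. \<exists>u. represents \<Omega> U u) \<and>
     (\<forall>U\<in>HX \<Omega> X. \<forall>V\<in>HX \<Omega> X.
        (AE x in lebesgue_on \<Omega>. fun_of \<Omega> U x = fun_of \<Omega> V x) \<longrightarrow> U = V) \<and>
     (\<exists>p_star::real. p_star > 2 \<and>
        (\<forall>p\<in>{1..p_star}. \<exists>C. \<forall>U\<in>HX \<Omega> X.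
           in_Lp \<Omega> p (fun_of \<Omega> U) \<and> Lp_norm \<Omega> p (fun_of \<Omega> U) \<le> C * HX_norm \<Omega> X U) \<and>
        (\<forall>p\<in>{1..<p_star}. \<forall>W::nat \<Rightarrow> 'n hx.
           (\<forall>k. W k \<in> HX \<Omega> X) \<and> (\<exists>M. \<forall>k. HX_norm \<Omega> X (W k) \<le> M) \<longrightarrow>
           (\<exists>r w. strict_mono (r::nat \<Rightarrow> nat) \<and> in_Lp \<Omega> p w \<and>
              (\<lambda>k. Lp_norm \<Omega> p (\<lambda>x. fun_of \<Omega> (W (r k)) x - w x)) \<longlonglongrightarrow> 0)))"

definition weak_solution ::
    "(real^'n) set \<Rightarrow> ('m::finite \<Rightarrow> real^'n \<Rightarrow> real^'n) \<Rightarrow> (real^'n \<Rightarrow> real^'n^'n) \<Rightarrow>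
     (real^'n \<Rightarrow> real) \<Rightarrow> (real \<Rightarrow> real) \<Rightarrow> (real^'n \<Rightarrow> real) \<Rightarrow> 'n hx \<Rightarrow> bool" where
  "weak_solution \<Omega> X B a g f U \<longleftrightarrow>
     U \<in> HX \<Omega> X \<and>
     integrable (lebesgue_on \<Omega>) (\<lambda>x. a x * g (fun_of \<Omega> U x)) \<and>
     (\<forall>V\<in>HX \<Omega> X. in_Linf \<Omega> (fun_of \<Omega> V) \<longrightarrow>
        L_form \<Omega> B U V + (LINT x|lebesgue_on \<Omega>. a x * g (fun_of \<Omega> U x) * fun_of \<Omega> V x)
          = (LINT x|lebesgue_on \<Omega>. f x * fun_of \<Omega> V x))"

end

theory Submission
  imports Defs
begin

text \<open>
  Let \<open>G\<close> be the antiderivative of \<open>g\<close> with \<open>G(0) = 0\<close>. The equation is the Euler--Lagrange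
  equation of the convex energy
  \<open>J(\<phi>) = 1/2 \<integral> B\<nabla>\<phi>\<cdot>\<nabla>\<phi> + \<integral> (a G(\<phi>) - f \<phi>)\<close>, and the solution is its minimizer. As \<open>a\<close> and \<open>f\<close> are
  only integrable, \<open>J\<close> need be neither finite nor differentiable on the whole completion, and everything
  depends on staying with bounded functions.

  Put \<open>k = g\<^sup>-\<^sup>1(Q)\<close>. The hypothesis \<open>\<bar>f\<bar> \<le> Q a\<close> makes \<open>s \<mapsto> a G(s) - f s\<close> nondecreasing for \<open>s \<ge> k\<close> and
  nonincreasing for \<open>s \<le> -k\<close>, so cutting a function off at the levels \<open>\<plusminus>k\<close> does not increase its energy;
  a \<open>C\<^sup>1\<close> cut-off (\<open>C1_truncation\<close>) keeps it in \<open>C\<^sup>1\<^sub>0\<close>. The infimum of \<open>J\<close> over \<open>C\<^sup>1\<^sub>0\<close> can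
  therefore be approached by functions \<open>w\<^sub>n\<close> with \<open>\<bar>w\<^sub>n\<bar> \<le> k + 1/(n+1)\<close> (\<open>minimizing_sequence\<close>). By the
  parallelogram identity such a sequence is Cauchy in the energy norm, which by ellipticity is
  equivalent to the \<open>X\<close>-norm; its limit \<open>U\<close> is bounded by \<open>k\<close>.

  A bounded element \<open>V\<close> of the completion has an approximating sequence of uniformly bounded test
  functions \<open>\<psi>\<^sub>n\<close> (\<open>bounded_approximation\<close>). Comparing \<open>w\<^sub>n\<close> with \<open>w\<^sub>n \<plusminus> t\<^sub>n \<psi>\<^sub>n\<close> for steps \<open>t\<^sub>n\<close> that tend
  to zero slowly enough, and passing to the limit once, by dominated convergence, gives the weak
  equation tested with \<open>V\<close> (\<open>weak_solution_exists\<close>). The difference of two bounded solutions is an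
  admissible test function, and monotonicity of \<open>g\<close> then makes its energy vanish
  (\<open>weak_solution_unique\<close>). The bound on the solution found is thereby a bound on every bounded solution.
\<close>

section \<open>Positive semidefinite forms on spaces of functions\<close>

text \<open>The vectors are concrete functions and not elements of an abstract space, so that limits of
  sequences in \<open>C\<close> can also be taken pointwise or in \<open>L\<^sup>1\<close>.\<close>

locale psd_form =
  fixes C :: "('a \<Rightarrow> real) set"
    and E :: "('a \<Rightarrow> real) \<Rightarrow> ('a \<Rightarrow> real) \<Rightarrow> real"
  assumes lincomb: "\<And>\<phi> \<psi> \<alpha> \<beta>. \<phi> \<in> C \<Longrightarrow> \<psi> \<in> C \<Longrightarrow> (\<lambda>x. \<alpha> * \<phi> x + \<beta> * \<psi> x) \<in> C"
    and form_lincomb: "\<And>\<phi> \<psi> \<eta> \<alpha> \<beta>. \<phi> \<in> C \<Longrightarrow> \<psi> \<in> C \<Longrightarrow> \<eta> \<in> C \<Longrightarrow>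
      E (\<lambda>x. \<alpha> * \<phi> x + \<beta> * \<psi> x) \<eta> = \<alpha> * E \<phi> \<eta> + \<beta> * E \<psi> \<eta>"
    and form_sym: "\<And>\<phi> \<psi>. \<phi> \<in> C \<Longrightarrow> \<psi> \<in> C \<Longrightarrow> E \<phi> \<psi> = E \<psi> \<phi>"
    and form_nonneg: "\<And>\<phi>. \<phi> \<in> C \<Longrightarrow> 0 \<le> E \<phi> \<phi>"
begin

definition nrm :: "('a \<Rightarrow> real) \<Rightarrow> real" where
  "nrm \<phi> = sqrt (E \<phi> \<phi>)"

definition cauchy :: "(nat \<Rightarrow> 'a \<Rightarrow> real) \<Rightarrow> bool" where
  "cauchy \<Phi> \<longleftrightarrow> (\<forall>n. \<Phi> n \<in> C) \<and>
     (\<forall>e>0. \<exists>M. \<forall>m\<ge>M. \<forall>n\<ge>M. nrm (\<lambda>x. \<Phi> m x - \<Phi> n x) < e)"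

lemma diff_in: "\<phi> \<in> C \<Longrightarrow> \<psi> \<in> C \<Longrightarrow> (\<lambda>x. \<phi> x - \<psi> x) \<in> C"
  using lincomb[of \<phi> \<psi> 1 "-1"] by simp

lemma form_diff_left:
  "\<phi> \<in> C \<Longrightarrow> \<psi> \<in> C \<Longrightarrow> \<eta> \<in> C \<Longrightarrow> E (\<lambda>x. \<phi> x - \<psi> x) \<eta> = E \<phi> \<eta> - E \<psi> \<eta>"
  using form_lincomb[of \<phi> \<psi> \<eta> 1 "-1"] by simp

lemma form_diff_right:
  "\<phi> \<in> C \<Longrightarrow> \<psi> \<in> C \<Longrightarrow> \<eta> \<in> C \<Longrightarrow> E \<eta> (\<lambda>x. \<phi> x - \<psi> x) = E \<eta> \<phi> - E \<eta> \<psi>"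
  using form_diff_left[of \<phi> \<psi> \<eta>] diff_in form_sym by simp

lemma form_expand:
  assumes "\<phi> \<in> C" "\<psi> \<in> C"
  shows "E (\<lambda>x. \<alpha> * \<phi> x + \<beta> * \<psi> x) (\<lambda>x. \<alpha> * \<phi> x + \<beta> * \<psi> x)
    = \<alpha>\<^sup>2 * E \<phi> \<phi> + 2 * \<alpha> * \<beta> * E \<phi> \<psi> + \<beta>\<^sup>2 * E \<psi> \<psi>"
proof -
  let ?w = "\<lambda>x. \<alpha> * \<phi> x + \<beta> * \<psi> x"
  have w: "?w \<in> C" using assms by (rule lincomb)
  have "E ?w ?w = \<alpha> * E ?w \<phi> + \<beta> * E ?w \<psi>"
    using form_lincomb[OF assms w] form_sym[OF w] assms by simp
  also have "\<dots> = \<alpha> * (\<alpha> * E \<phi> \<phi> + \<beta> * E \<psi> \<phi>) + \<beta> * (\<alpha> * E \<phi> \<psi> + \<beta> * E \<psi> \<psi>)"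
    using assms by (simp add: form_lincomb)
  finally show ?thesis
    using form_sym[OF assms] by (simp add: algebra_simps power2_eq_square)
qed

lemma form_midpoint:
  assumes "\<phi> \<in> C" "\<psi> \<in> C"
  shows "E (\<lambda>x. (\<phi> x + \<psi> x) / 2) (\<lambda>x. (\<phi> x + \<psi> x) / 2)
    = (E \<phi> \<phi> + E \<psi> \<psi>) / 2 - E (\<lambda>x. \<phi> x - \<psi> x) (\<lambda>x. \<phi> x - \<psi> x) / 4"
proof -
  have "E (\<lambda>x. (\<phi> x + \<psi> x) / 2) (\<lambda>x. (\<phi> x + \<psi> x) / 2) = E \<phi> \<phi> / 4 + E \<phi> \<psi> / 2 + E \<psi> \<psi> / 4"
    using form_expand[OF assms, of "1/2" "1/2"] by (simp add: add_divide_distrib power2_eq_square)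
  moreover have "E (\<lambda>x. \<phi> x - \<psi> x) (\<lambda>x. \<phi> x - \<psi> x) = E \<phi> \<phi> - 2 * E \<phi> \<psi> + E \<psi> \<psi>"
    using form_expand[OF assms, of 1 "-1"] by simp
  ultimately show ?thesis by argo
qed

text \<open>The discriminant argument: the form is nonnegative on
  \<open>E \<psi> \<psi> \<cdot> \<phi> - E \<phi> \<psi> \<cdot> \<psi>\<close>. If both diagonal values vanish, the form on \<open>\<phi> \<plusminus> \<psi>\<close> is
  \<open>\<plusminus> 2 E \<phi> \<psi>\<close>, so this vanishes too.\<close>

lemma form_square_le:
  assumes "\<phi> \<in> C" "\<psi> \<in> C"
  shows "(E \<phi> \<psi>)\<^sup>2 \<le> E \<phi> \<phi> * E \<psi> \<psi>"
proof -
  have key: "(E u v)\<^sup>2 \<le> E u u * E v v" if "u \<in> C" "v \<in> C" "E v v > 0" for u v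
  proof -
    have "0 \<le> (E v v)\<^sup>2 * E u u + 2 * E v v * (- E u v) * E u v + (- E u v)\<^sup>2 * E v v"
      using form_nonneg[OF lincomb[OF that(1,2)]] form_expand[OF that(1,2)] by metis
    also have "\<dots> = E v v * (E u u * E v v - (E u v)\<^sup>2)"
      by (simp add: algebra_simps power2_eq_square)
    finally show ?thesis using that(3) by (simp add: zero_le_mult_iff)
  qed
  have "0 \<le> E \<phi> \<phi>" "0 \<le> E \<psi> \<psi>" using assms by (simp_all add: form_nonneg)
  then consider "E \<psi> \<psi> > 0" | "E \<phi> \<phi> > 0" | "E \<psi> \<psi> = 0" "E \<phi> \<phi> = 0"
    by (auto simp: less_le)
  then show ?thesis
  proof cases
    case 1 then show ?thesis using key assms by blast
  next
    case 2 then show ?thesis using key[of \<psi> \<phi>] assms form_sym[OF assms] by (simp add: mult.commute)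
  next
    case 3
    have "0 \<le> 2 * \<beta> * E \<phi> \<psi>" for \<beta>
      using form_nonneg[OF lincomb[OF assms, of 1 \<beta>]] form_expand[OF assms, of 1 \<beta>] 3
      by simp
    from this[of 1] this[of "-1"] 3 show ?thesis by simp
  qed
qed

lemma nrm_nonneg: "\<phi> \<in> C \<Longrightarrow> 0 \<le> nrm \<phi>"
  by (simp add: nrm_def form_nonneg)

lemma nrm_square: "\<phi> \<in> C \<Longrightarrow> (nrm \<phi>)\<^sup>2 = E \<phi> \<phi>"
  by (simp add: nrm_def form_nonneg)

lemma Cauchy_Schwarz:
  assumes "\<phi> \<in> C" "\<psi> \<in> C"
  shows "\<bar>E \<phi> \<psi>\<bar> \<le> nrm \<phi> * nrm \<psi>"
proof -
  have "\<bar>E \<phi> \<psi>\<bar> = sqrt ((E \<phi> \<psi>)\<^sup>2)" by simp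
  also have "\<dots> \<le> sqrt (E \<phi> \<phi> * E \<psi> \<psi>)" using form_square_le[OF assms] by (rule real_sqrt_le_mono)
  finally show ?thesis by (simp add: nrm_def real_sqrt_mult)
qed

lemma nrm_triangle:
  assumes "\<phi> \<in> C" "\<psi> \<in> C"
  shows "nrm (\<lambda>x. \<phi> x - \<psi> x) \<le> nrm \<phi> + nrm \<psi>"
proof -
  have "(nrm (\<lambda>x. \<phi> x - \<psi> x))\<^sup>2 = E \<phi> \<phi> - 2 * E \<phi> \<psi> + E \<psi> \<psi>"
    using form_expand[OF assms, of 1 "-1"] diff_in[OF assms] by (simp add: nrm_square)
  also have "\<dots> \<le> (nrm \<phi> + nrm \<psi>)\<^sup>2"
    using Cauchy_Schwarz[OF assms] by (simp add: power2_sum nrm_square assms)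
  finally show ?thesis using nrm_nonneg assms by (meson add_nonneg_nonneg power2_le_imp_le)
qed

lemma nrm_diff_commute:
  assumes "\<phi> \<in> C" "\<psi> \<in> C"
  shows "nrm (\<lambda>x. \<phi> x - \<psi> x) = nrm (\<lambda>x. \<psi> x - \<phi> x)"
  using form_expand[OF assms, of 1 "-1"] form_expand[OF assms, of "-1" 1]
  by (simp add: nrm_def algebra_simps)

lemma nrm_diff_triangle:
  assumes "\<phi> \<in> C" "\<psi> \<in> C" "\<eta> \<in> C"
  shows "nrm (\<lambda>x. \<phi> x - \<eta> x) \<le> nrm (\<lambda>x. \<phi> x - \<psi> x) + nrm (\<lambda>x. \<psi> x - \<eta> x)"
  using nrm_triangle[OF diff_in[OF assms(1,2)] diff_in[OF assms(3,2)]]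
    nrm_diff_commute[OF assms(2,3)] by simp

lemma cauchy_in: "cauchy \<Phi> \<Longrightarrow> \<Phi> n \<in> C"
  by (simp add: cauchy_def)

lemma cauchy_bounded:
  assumes "cauchy \<Phi>"
  obtains M where "M > 0" "\<And>n. nrm (\<Phi> n) \<le> M"
proof -
  obtain N where N: "\<And>m n. m \<ge> N \<Longrightarrow> n \<ge> N \<Longrightarrow> nrm (\<lambda>x. \<Phi> m x - \<Phi> n x) < 1"
    using assms unfolding cauchy_def by (meson zero_less_one)
  define M where "M = Max ((\<lambda>n. nrm (\<Phi> n)) ` {..N}) + 1"
  have le: "nrm (\<Phi> n) \<le> M - 1" if "n \<le> N" for n
    unfolding M_def using that by (simp add: Max_ge_iff)
  have "nrm (\<Phi> n) \<le> M" for n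
  proof (cases "n \<le> N")
    case False
    have z: "(\<lambda>x. \<Phi> N x - \<Phi> n x) \<in> C" using assms by (simp add: cauchy_in diff_in)
    have "nrm (\<Phi> n) \<le> nrm (\<Phi> N) + nrm (\<lambda>x. \<Phi> N x - \<Phi> n x)"
      using nrm_triangle[OF cauchy_in[OF assms, of N] z] by simp
    then show ?thesis using N[of N n] le[of N] False by simp
  qed (use le in force)
  moreover have "M > 0"
    using le[of 0] nrm_nonneg[OF cauchy_in[OF assms, of 0]] by simp
  ultimately show ?thesis using that by blast
qed

lemma cauchy_diff:
  assumes "cauchy \<Phi>" "cauchy \<Psi>"
  shows "cauchy (\<lambda>n x. \<Phi> n x - \<Psi> n x)"
  unfolding cauchy_def
proof (intro conjI allI impI)
  show "(\<lambda>x. \<Phi> n x - \<Psi> n x) \<in> C" for n using assms by (simp add: cauchy_in diff_in)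
  fix e :: real assume "e > 0"
  then obtain M1 M2
    where M1: "\<And>m n. m \<ge> M1 \<Longrightarrow> n \<ge> M1 \<Longrightarrow> nrm (\<lambda>x. \<Phi> m x - \<Phi> n x) < e / 2"
      and M2: "\<And>m n. m \<ge> M2 \<Longrightarrow> n \<ge> M2 \<Longrightarrow> nrm (\<lambda>x. \<Psi> m x - \<Psi> n x) < e / 2"
    using assms unfolding cauchy_def by (meson half_gt_zero)
  show "\<exists>M. \<forall>m\<ge>M. \<forall>n\<ge>M. nrm (\<lambda>x. \<Phi> m x - \<Psi> m x - (\<Phi> n x - \<Psi> n x)) < e"
  proof (intro exI allI impI)
    fix m n assume "m \<ge> max M1 M2" "n \<ge> max M1 M2"
    then have "nrm (\<lambda>x. \<Phi> m x - \<Phi> n x) + nrm (\<lambda>x. \<Psi> m x - \<Psi> n x) < e"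
      using M1[of m n] M2[of m n] by simp
    moreover have "nrm (\<lambda>x. (\<Phi> m x - \<Phi> n x) - (\<Psi> m x - \<Psi> n x))
        \<le> nrm (\<lambda>x. \<Phi> m x - \<Phi> n x) + nrm (\<lambda>x. \<Psi> m x - \<Psi> n x)"
      using assms by (intro nrm_triangle diff_in cauchy_in)
    moreover have "(\<lambda>x. (\<Phi> m x - \<Phi> n x) - (\<Psi> m x - \<Psi> n x))
        = (\<lambda>x. \<Phi> m x - \<Psi> m x - (\<Phi> n x - \<Psi> n x))"
      by (simp add: fun_eq_iff)
    ultimately show "nrm (\<lambda>x. \<Phi> m x - \<Psi> m x - (\<Phi> n x - \<Psi> n x)) < e" by simp
  qed
qed

lemma cauchy_subseq:
  assumes "cauchy \<Phi>" "strict_mono r"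
  shows "cauchy (\<Phi> \<circ> r)" "(\<lambda>n. nrm (\<lambda>x. \<Phi> n x - (\<Phi> \<circ> r) n x)) \<longlonglongrightarrow> 0"
proof -
  have r: "n \<le> r n" for n using assms(2) by (rule strict_mono_imp_increasing)
  show "cauchy (\<Phi> \<circ> r)"
    unfolding cauchy_def comp_def
    using assms(1) order_trans[OF _ r] unfolding cauchy_def by meson
  show "(\<lambda>n. nrm (\<lambda>x. \<Phi> n x - (\<Phi> \<circ> r) n x)) \<longlonglongrightarrow> 0"
  proof (rule LIMSEQ_I)
    fix e :: real assume "e > 0"
    then obtain M where "\<And>m n. m \<ge> M \<Longrightarrow> n \<ge> M \<Longrightarrow> nrm (\<lambda>x. \<Phi> m x - \<Phi> n x) < e"
      using assms(1) unfolding cauchy_def by meson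
    then have "norm (nrm (\<lambda>x. \<Phi> n x - (\<Phi> \<circ> r) n x) - 0) < e" if "n \<ge> M" for n
      using that order_trans[OF that r] nrm_nonneg[OF diff_in] cauchy_in[OF assms(1)] by simp
    then show "\<exists>no. \<forall>n\<ge>no. norm (nrm (\<lambda>x. \<Phi> n x - (\<Phi> \<circ> r) n x) - 0) < e" by blast
  qed
qed

lemma form_tendsto_0:
  assumes "\<And>n. \<alpha> n \<in> C" "\<And>n. \<beta> n \<in> C" "(\<lambda>n. nrm (\<alpha> n)) \<longlonglongrightarrow> 0" "\<And>n. nrm (\<beta> n) \<le> M"
  shows "(\<lambda>n. E (\<alpha> n) (\<beta> n)) \<longlonglongrightarrow> 0"
proof (rule Lim_null_comparison)
  have "norm (E (\<alpha> n) (\<beta> n)) \<le> nrm (\<alpha> n) * M" for n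
    using order_trans[OF Cauchy_Schwarz[OF assms(1,2)] mult_left_mono[OF assms(4) nrm_nonneg[OF assms(1)]]]
    by simp
  then show "\<forall>\<^sub>F n in sequentially. norm (E (\<alpha> n) (\<beta> n)) \<le> nrm (\<alpha> n) * M" by simp
  show "(\<lambda>n. nrm (\<alpha> n) * M) \<longlonglongrightarrow> 0" using tendsto_mult_left_zero[OF assms(3)] .
qed

lemma form_convergent:
  assumes "cauchy \<Phi>" "cauchy \<Psi>"
  shows "convergent (\<lambda>n. E (\<Phi> n) (\<Psi> n))"
proof -
  obtain M1 where M1: "M1 > 0" "\<And>n. nrm (\<Phi> n) \<le> M1" using cauchy_bounded[OF assms(1)] by blast
  obtain M2 where M2: "M2 > 0" "\<And>n. nrm (\<Psi> n) \<le> M2" using cauchy_bounded[OF assms(2)] by blast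
  note C = cauchy_in[OF assms(1)] cauchy_in[OF assms(2)]
  have "Cauchy (\<lambda>n. E (\<Phi> n) (\<Psi> n))"
  proof (rule CauchyI)
    fix e :: real assume "e > 0"
    then have "e / (2 * M1) > 0" "e / (2 * M2) > 0" using M1 M2 by simp_all
    then obtain N1 N2
      where N1: "\<And>m n. m \<ge> N1 \<Longrightarrow> n \<ge> N1 \<Longrightarrow> nrm (\<lambda>x. \<Phi> m x - \<Phi> n x) < e / (2 * M2)"
        and N2: "\<And>m n. m \<ge> N2 \<Longrightarrow> n \<ge> N2 \<Longrightarrow> nrm (\<lambda>x. \<Psi> m x - \<Psi> n x) < e / (2 * M1)"
      using assms unfolding cauchy_def by meson
    have "\<bar>E (\<Phi> m) (\<Psi> m) - E (\<Phi> n) (\<Psi> n)\<bar> < e" if "m \<ge> max N1 N2" "n \<ge> max N1 N2" for m n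
    proof -
      have "E (\<Phi> m) (\<Psi> m) - E (\<Phi> n) (\<Psi> n)
          = E (\<lambda>x. \<Phi> m x - \<Phi> n x) (\<Psi> m) + E (\<Phi> n) (\<lambda>x. \<Psi> m x - \<Psi> n x)"
        using C by (simp add: form_diff_left form_diff_right)
      moreover have "\<bar>E (\<lambda>x. \<Phi> m x - \<Phi> n x) (\<Psi> m)\<bar> < e / 2"
      proof -
        have "\<bar>E (\<lambda>x. \<Phi> m x - \<Phi> n x) (\<Psi> m)\<bar> \<le> nrm (\<lambda>x. \<Phi> m x - \<Phi> n x) * nrm (\<Psi> m)"
          using C by (intro Cauchy_Schwarz diff_in)
        also have "\<dots> \<le> nrm (\<lambda>x. \<Phi> m x - \<Phi> n x) * M2"
          using C M2 by (intro mult_left_mono nrm_nonneg diff_in)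
        also have "\<dots> < e / (2 * M2) * M2"
          using N1[of m n] that M2(1) by (intro mult_strict_right_mono) auto
        finally show ?thesis using M2(1) by simp
      qed
      moreover have "\<bar>E (\<Phi> n) (\<lambda>x. \<Psi> m x - \<Psi> n x)\<bar> < e / 2"
      proof -
        have "\<bar>E (\<Phi> n) (\<lambda>x. \<Psi> m x - \<Psi> n x)\<bar> \<le> nrm (\<Phi> n) * nrm (\<lambda>x. \<Psi> m x - \<Psi> n x)"
          using C by (intro Cauchy_Schwarz diff_in)
        also have "\<dots> \<le> M1 * nrm (\<lambda>x. \<Psi> m x - \<Psi> n x)"
          using C M1 by (intro mult_right_mono nrm_nonneg diff_in)
        also have "\<dots> < M1 * (e / (2 * M1))"
          using N2[of m n] that M1(1) by (intro mult_strict_left_mono) auto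
        finally show ?thesis using M1(1) by simp
      qed
      ultimately show ?thesis by linarith
    qed
    then show "\<exists>N. \<forall>m\<ge>N. \<forall>n\<ge>N. norm (E (\<Phi> m) (\<Psi> m) - E (\<Phi> n) (\<Psi> n)) < e"
      by (intro exI[of _ "max N1 N2"]) simp
  qed
  then show ?thesis by (simp add: Cauchy_convergent_iff)
qed

text \<open>The limit of the form along Cauchy sequences depends only on their classes, so the form
  extends to the completion.\<close>

lemma form_limit_cong:
  assumes "cauchy \<Phi>" "cauchy \<Psi>" "cauchy \<Phi>'" "cauchy \<Psi>'"
    and "(\<lambda>n. nrm (\<lambda>x. \<Phi>' n x - \<Phi> n x)) \<longlonglongrightarrow> 0"
    and "(\<lambda>n. nrm (\<lambda>x. \<Psi>' n x - \<Psi> n x)) \<longlonglongrightarrow> 0"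
    and lim: "(\<lambda>n. E (\<Phi> n) (\<Psi> n)) \<longlonglongrightarrow> l"
  shows "(\<lambda>n. E (\<Phi>' n) (\<Psi>' n)) \<longlonglongrightarrow> l"
proof -
  note C = assms(1-4)[THEN cauchy_in]
  obtain M1 where M1: "\<And>n. nrm (\<Phi> n) \<le> M1" using cauchy_bounded[OF assms(1)] by blast
  obtain M2 where M2: "\<And>n. nrm (\<Psi>' n) \<le> M2" using cauchy_bounded[OF assms(4)] by blast
  have 1: "(\<lambda>n. E (\<lambda>x. \<Phi>' n x - \<Phi> n x) (\<Psi>' n)) \<longlonglongrightarrow> 0"
    using C M2 assms by (intro form_tendsto_0) (auto intro: diff_in)
  have 2: "(\<lambda>n. E (\<lambda>x. \<Psi>' n x - \<Psi> n x) (\<Phi> n)) \<longlonglongrightarrow> 0"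
    using C M1 assms by (intro form_tendsto_0) (auto intro: diff_in)
  have "E (\<Phi>' n) (\<Psi>' n) = E (\<Phi> n) (\<Psi> n)
      + (E (\<lambda>x. \<Phi>' n x - \<Phi> n x) (\<Psi>' n) + E (\<lambda>x. \<Psi>' n x - \<Psi> n x) (\<Phi> n))" for n
    using C form_sym[OF C(1,2)] form_sym[OF C(1,4)] by (simp add: form_diff_left)
  then show ?thesis using tendsto_add[OF lim tendsto_add[OF 1 2]] by simp
qed

text \<open>A substitute for weak compactness, used twice. Almost-minimizers \<open>z\<^sub>n\<close> of \<open>J\<close> over a decreasing
  sequence of midpoint-convex sets form a Cauchy sequence: the midpoint of \<open>z\<^sub>m\<close> and \<open>z\<^sub>n\<close>, for
  \<open>m, n \<ge> p\<close>, lies in \<open>K\<^sub>p\<close>, and its value cannot fall below the infimum over \<open>K\<^sub>p\<close>, while these infima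
  increase to a finite limit. Letting the sets shrink builds side conditions such as an \<open>L\<^sup>1\<close> limit
  or an asymptotic bound into the sequence.\<close>

lemma nested_minimization:
  assumes K_sub: "\<And>n. K n \<subseteq> C" and K_mono: "\<And>n. K (Suc n) \<subseteq> K n"
    and K_mid: "\<And>n \<phi> \<psi>. \<phi> \<in> K n \<Longrightarrow> \<psi> \<in> K n \<Longrightarrow> (\<lambda>x. (\<phi> x + \<psi> x) / 2) \<in> K n"
    and low: "\<And>\<phi>. \<phi> \<in> K 0 \<Longrightarrow> b \<le> J \<phi>"
    and up: "\<And>n. \<exists>\<phi>\<in>K n. J \<phi> \<le> M"
    and "0 < c"
    and mid: "\<And>\<phi> \<psi>. \<phi> \<in> K 0 \<Longrightarrow> \<psi> \<in> K 0 \<Longrightarrow>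
      J (\<lambda>x. (\<phi> x + \<psi> x) / 2) \<le> (J \<phi> + J \<psi>) / 2 - c * E (\<lambda>x. \<phi> x - \<psi> x) (\<lambda>x. \<phi> x - \<psi> x)"
  obtains z d where "\<And>n. z n \<in> K n" "cauchy z" "(\<lambda>n. J (z n)) \<longlonglongrightarrow> d"
    "\<forall>v. (\<forall>n. \<exists>\<phi>\<in>K n. J \<phi> \<le> v) \<longrightarrow> d \<le> v"
proof -
  have anti: "K n \<subseteq> K m" if "m \<le> n" for m n
    using lift_Suc_antimono_le[of K, OF K_mono that] .
  define D where "D n = Inf (J ` K n)" for n
  have bdd: "bdd_below (J ` K n)" for n
    using low anti[of 0 n] by (intro bdd_belowI[of _ b]) auto
  have ne: "K n \<noteq> {}" for n using up[of n] by auto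
  have D_le: "D n \<le> J \<phi>" if "\<phi> \<in> K n" for n \<phi>
    unfolding D_def using bdd that by (intro cInf_lower) auto
  have D_mono: "D m \<le> D n" if "m \<le> n" for m n
    unfolding D_def using anti[OF that] bdd ne by (intro cInf_superset_mono) auto
  have D_up: "D n \<le> v" if "\<And>n. \<exists>\<phi>\<in>K n. J \<phi> \<le> v" for n v
    using that[of n] D_le order_trans by blast
  obtain d where d: "D \<longlonglongrightarrow> d" "\<And>n. D n \<le> d"
    using incseq_convergent[of D M] D_mono D_up[OF up] by (auto simp: incseq_def)
  have "\<exists>\<phi>\<in>K n. J \<phi> < D n + 1 / Suc n" for n
  proof -
    have "Inf (J ` K n) < D n + 1 / Suc n" by (simp add: D_def)
    then show ?thesis using cInf_lessD[of "J ` K n"] ne by blast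
  qed
  then obtain z where z: "\<And>n. z n \<in> K n" "\<And>n. J (z n) < D n + 1 / Suc n" by metis
  have lim0: "(\<lambda>n. 1 / real (Suc n)) \<longlonglongrightarrow> 0" using lim_1_over_n LIMSEQ_Suc by blast
  have Jz: "(\<lambda>n. J (z n)) \<longlonglongrightarrow> d"
  proof (rule tendsto_sandwich[OF _ _ d(1)])
    show "\<forall>\<^sub>F n in sequentially. D n \<le> J (z n)" using D_le z(1) by simp
    show "\<forall>\<^sub>F n in sequentially. J (z n) \<le> D n + 1 / Suc n" using z(2) by (simp add: less_imp_le)
    show "(\<lambda>n. D n + 1 / Suc n) \<longlonglongrightarrow> d" using tendsto_add[OF d(1) lim0] by simp
  qed
  have zC: "z n \<in> C" for n using z(1) K_sub by blast
  have est: "c * E (\<lambda>x. z m x - z n x) (\<lambda>x. z m x - z n x) \<le> d - D p + 1 / Suc p"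
    if "m \<ge> p" "n \<ge> p" for m n p
  proof -
    \<comment> \<open>The midpoint still competes for the infimum over \<open>K\<^sub>p\<close>.\<close>
    have "D p \<le> J (\<lambda>x. (z m x + z n x) / 2)"
      using anti[OF that(1)] anti[OF that(2)] z(1) by (intro D_le K_mid) auto
    also have "\<dots> \<le> (J (z m) + J (z n)) / 2 - c * E (\<lambda>x. z m x - z n x) (\<lambda>x. z m x - z n x)"
      using anti[of 0 m] anti[of 0 n] z(1) by (intro mid) auto
    finally have "c * E (\<lambda>x. z m x - z n x) (\<lambda>x. z m x - z n x) \<le> (J (z m) + J (z n)) / 2 - D p"
      by simp
    moreover have "J (z q) \<le> d + 1 / Suc p" if "q \<ge> p" for q
    proof -
      have "1 / real (Suc q) \<le> 1 / Suc p" using that by (intro divide_left_mono) auto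
      then show ?thesis using z(2)[of q] d(2)[of q] by linarith
    qed
    note this[OF that(1)] this[OF that(2)]
    ultimately show ?thesis by argo
  qed
  have "cauchy z"
    unfolding cauchy_def
  proof (intro conjI allI impI zC)
    fix e :: real assume "e > 0"
    have "(\<lambda>p. d - D p + 1 / Suc p) \<longlonglongrightarrow> 0"
      using tendsto_add[OF tendsto_diff[OF tendsto_const[of d] d(1)] lim0] by simp
    moreover have "0 < c * e\<^sup>2" using \<open>e > 0\<close> \<open>c > 0\<close> by simp
    ultimately have "\<forall>\<^sub>F p in sequentially. d - D p + 1 / Suc p < c * e\<^sup>2"
      by (rule order_tendstoD)
    then obtain p where p: "d - D p + 1 / Suc p < c * e\<^sup>2"
      using eventually_happens'[OF sequentially_bot] by blast
    have "nrm (\<lambda>x. z m x - z n x) < e" if "m \<ge> p" "n \<ge> p" for m n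
    proof -
      have "c * (nrm (\<lambda>x. z m x - z n x))\<^sup>2 < c * e\<^sup>2"
        using est[OF that] p by (simp add: nrm_square diff_in zC)
      then show ?thesis using \<open>c > 0\<close> \<open>e > 0\<close> by (simp add: power_less_imp_less_base)
    qed
    then show "\<exists>M. \<forall>m\<ge>M. \<forall>n\<ge>M. nrm (\<lambda>x. z m x - z n x) < e" by blast
  qed
  moreover have "\<forall>v. (\<forall>n. \<exists>\<phi>\<in>K n. J \<phi> \<le> v) \<longrightarrow> d \<le> v"
  proof (intro allI impI)
    fix v assume "\<forall>n. \<exists>\<phi>\<in>K n. J \<phi> \<le> v"
    then have "D n \<le> v" for n using D_up by blast
    then show "d \<le> v" by (intro LIMSEQ_le_const2[OF d(1)]) auto
  qed
  ultimately show ?thesis using that z(1) Jz by blast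
qed

end

section \<open>Auxiliary real functions\<close>

text \<open>A \<open>C\<^sup>1\<close> version of the cut-off at \<open>\<plusminus>k\<close>, which moves no value upwards in modulus and exceeds the
  levels \<open>\<plusminus>k\<close> by at most \<open>\<epsilon>\<close>. For \<open>s > k\<close> it is \<open>k + \<epsilon> (s - k) / (\<epsilon> + s - k)\<close>.\<close>

lemma C1_truncation:
  fixes k \<epsilon> :: real
  assumes "0 \<le> k" "0 < \<epsilon>"
  obtains \<theta> \<theta>' where "\<And>s. (\<theta> has_real_derivative \<theta>' s) (at s)" "continuous_on UNIV \<theta>'"
    "\<And>s. 0 \<le> \<theta>' s" "\<And>s. \<theta>' s \<le> 1" "\<And>s. \<bar>s\<bar> \<le> k \<Longrightarrow> \<theta> s = s" "\<And>s. \<bar>\<theta> s\<bar> \<le> k + \<epsilon>"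
    "\<And>s. k \<le> s \<Longrightarrow> k \<le> \<theta> s \<and> \<theta> s \<le> s" "\<And>s. s \<le> - k \<Longrightarrow> s \<le> \<theta> s \<and> \<theta> s \<le> - k"
proof -
  \<comment> \<open>\<open>\<rho>\<close> is the amount removed by the cut-off at distance \<open>y\<close> beyond the level; it vanishes to second order at \<open>0\<close>.\<close>
  define \<rho> where "\<rho> y = (if y \<le> 0 then 0 else y - \<epsilon> * y / (\<epsilon> + y))" for y :: real
  define \<rho>' where "\<rho>' y = 1 - (\<epsilon> / (\<epsilon> + max y 0))\<^sup>2" for y :: real
  have d: "(\<rho> has_real_derivative \<rho>' y) (at y)" for y
  proof -
    consider "y < 0" | "y = 0" | "y > 0" by linarith
    then show ?thesis
    proof cases
      case 1
      have "((\<lambda>y. 0) has_real_derivative \<rho>' y) (at y)"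
        using 1 assms by (simp add: \<rho>'_def)
      then show ?thesis
        by (rule has_field_derivative_transform_within_open[of _ _ _ "{..<0}"]) (use 1 in \<open>auto simp: \<rho>_def\<close>)
    next
      case 3
      have ne: "\<epsilon> + y \<noteq> 0" using 3 assms by simp
      have "((\<lambda>y. y - \<epsilon> * y / (\<epsilon> + y)) has_real_derivative
          1 - (\<epsilon> * (\<epsilon> + y) - \<epsilon> * y) / ((\<epsilon> + y) * (\<epsilon> + y))) (at y)"
        by (rule derivative_eq_intros refl ne | simp)+
      moreover have "1 - (\<epsilon> * (\<epsilon> + y) - \<epsilon> * y) / ((\<epsilon> + y) * (\<epsilon> + y)) = \<rho>' y"
        using 3 assms by (simp add: \<rho>'_def power2_eq_square algebra_simps)
      ultimately have "((\<lambda>y. y - \<epsilon> * y / (\<epsilon> + y)) has_real_derivative \<rho>' y) (at y)"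
        by simp
      then show ?thesis
        by (rule has_field_derivative_transform_within_open[of _ _ _ "{0<..}"]) (use 3 in \<open>auto simp: \<rho>_def\<close>)
    next
      case 2
      have b: "\<bar>\<rho> h / h\<bar> \<le> \<bar>h\<bar> / \<epsilon>" for h
        using assms by (auto simp: \<rho>_def divide_simps abs_if) (auto simp: algebra_simps)
      have "((\<lambda>h. \<bar>h\<bar> / \<epsilon>) \<longlongrightarrow> 0) (at 0)" using assms by (auto intro!: tendsto_eq_intros)
      then have "((\<lambda>h. \<rho> h / h) \<longlongrightarrow> 0) (at 0)"
        by (rule Lim_null_comparison[rotated]) (use b in simp)
      then show ?thesis using 2 assms by (simp add: DERIV_def \<rho>'_def \<rho>_def)
    qed
  qed
  have \<rho>_b: "\<rho> y = 0" if "y \<le> 0" for y using that by (simp add: \<rho>_def)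
  have \<rho>_p: "0 \<le> \<rho> y \<and> \<rho> y \<le> y \<and> y \<le> \<rho> y + \<epsilon>" if "y \<ge> 0" for y
    using that assms by (auto simp: \<rho>_def field_simps)
  have \<rho>'_b: "0 \<le> \<rho>' y \<and> \<rho>' y \<le> 1" for y
    using assms by (auto simp: \<rho>'_def power_le_one)
  have \<rho>'_n: "\<rho>' y = 0" if "y \<le> 0" for y using that assms by (simp add: \<rho>'_def max_absorb2)
  have cont: "continuous_on UNIV \<rho>'"
    unfolding \<rho>'_def using assms by (intro continuous_intros) (auto simp: max_def)
  define \<theta> where "\<theta> s = s - \<rho> (s - k) + \<rho> (- s - k)" for s
  define \<theta>' where "\<theta>' s = 1 - \<rho>' (s - k) - \<rho>' (- s - k)" for s
  show ?thesis
  proof (rule that[of \<theta> \<theta>'])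
    show "(\<theta> has_real_derivative \<theta>' s) (at s)" for s
      unfolding \<theta>_def \<theta>'_def
      by (rule derivative_eq_intros DERIV_chain2[OF d] refl | simp)+
    show "continuous_on UNIV \<theta>'"
      unfolding \<theta>'_def by (intro continuous_intros continuous_on_compose2[OF cont]) auto
    have "\<rho>' (s - k) = 0 \<or> \<rho>' (- s - k) = 0" for s
      using \<rho>'_n[of "s - k"] \<rho>'_n[of "- s - k"] assms by linarith
    then show "0 \<le> \<theta>' s" "\<theta>' s \<le> 1" for s
      unfolding \<theta>'_def using \<rho>'_b[of "s - k"] \<rho>'_b[of "- s - k"] by (smt (verit))+
    show "\<theta> s = s" if "\<bar>s\<bar> \<le> k" for s
      unfolding \<theta>_def using that \<rho>_b[of "s - k"] \<rho>_b[of "- s - k"] by simp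
    show "k \<le> \<theta> s \<and> \<theta> s \<le> s" if "k \<le> s" for s
      unfolding \<theta>_def using that assms \<rho>_p[of "s - k"] \<rho>_b[of "- s - k"] by simp
    show "s \<le> \<theta> s \<and> \<theta> s \<le> - k" if "s \<le> - k" for s
      unfolding \<theta>_def using that assms \<rho>_b[of "s - k"] \<rho>_p[of "- s - k"] by simp
    show "\<bar>\<theta> s\<bar> \<le> k + \<epsilon>" for s
      unfolding \<theta>_def
      using assms \<rho>_b[of "s - k"] \<rho>_p[of "- s - k"] \<rho>_p[of "s - k"] \<rho>_b[of "- s - k"]
      by (smt (verit))
  qed
qed

text \<open>The antiderivative of an increasing function is convex: its graph lies above its tangents.\<close>

lemma monotone_antiderivative:
  fixes g :: "real \<Rightarrow> real"
  assumes "continuous_on UNIV g" "mono g"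
  obtains G where "continuous_on UNIV G" "G 0 = 0" "\<And>x y. g x * (y - x) \<le> G y - G x"
proof -
  obtain F where F: "\<And>x. (F has_real_derivative g x) (at x)"
    using einterval_antiderivative[of "-\<infinity>" \<infinity> g] assms(1)
    by (auto simp: continuous_on_eq_continuous_at has_real_derivative_iff_has_vector_derivative)
  define G where "G x = F x - F 0" for x
  have G: "(G has_real_derivative g x) (at x)" for x
    unfolding G_def by (auto intro!: derivative_eq_intros F)
  have "g x * (y - x) \<le> G y - G x" for x y
  proof -
    consider "x = y" | "x < y" | "y < x" by linarith
    then show ?thesis
    proof cases
      case 2
      obtain z where "x < z" "z < y" "G y - G x = (y - x) * g z"
        using MVT2[OF 2 G] by blast
      moreover have "g x \<le> g z" using \<open>x < z\<close> assms(2) by (simp add: monoD)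
      ultimately show ?thesis using 2 by (simp add: mult.commute mult_right_mono)
    next
      case 3
      obtain z where "y < z" "z < x" "G x - G y = (x - y) * g z"
        using MVT2[OF 3 G] by blast
      moreover have "(x - y) * g z \<le> (x - y) * g x"
        using 3 \<open>z < x\<close> assms(2) by (intro mult_left_mono) (auto simp: monoD)
      ultimately show ?thesis by (simp add: algebra_simps)
    qed simp
  qed
  moreover have "continuous_on UNIV G"
    using G by (meson DERIV_isCont continuous_on_eq_continuous_at open_UNIV)
  ultimately show ?thesis using that by (simp add: G_def)
qed

text \<open>For increasing \<open>g\<close> the limit at infinity is the supremum, so a value below it is exceeded
  somewhere and, by continuity, attained.\<close>

lemma level_attained:
  fixes g :: "real \<Rightarrow> real"
  assumes "continuous_on UNIV g" "mono g" "g 0 = 0" "0 < Q" "ereal Q < Lim at_top (\<lambda>s. ereal (g s))"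
  obtains k where "0 < k" "g k = Q"
proof -
  have "((\<lambda>s. ereal (g s)) \<longlongrightarrow> (SUP s. ereal (g s))) at_top"
  proof (rule order_tendstoI)
    fix y assume "y < (SUP s. ereal (g s))"
    then obtain s where s: "y < ereal (g s)" by (auto simp: less_SUP_iff)
    show "\<forall>\<^sub>F t in at_top. y < ereal (g t)"
      using eventually_ge_at_top[of s]
    proof eventually_elim
      case (elim t)
      then have "ereal (g s) \<le> ereal (g t)" using assms(2) by (simp add: monoD)
      with s show ?case by (rule less_le_trans)
    qed
  next
    fix y assume y: "(SUP s. ereal (g s)) < y"
    have "ereal (g t) < y" for t
      by (rule le_less_trans[OF SUP_upper y]) simp
    then show "\<forall>\<^sub>F t in at_top. ereal (g t) < y" by simp
  qed
  then have "Lim at_top (\<lambda>s. ereal (g s)) = (SUP s. ereal (g s))"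
    by (intro tendsto_Lim) simp
  then obtain s where s: "Q < g s" using assms(5) by (auto simp: less_SUP_iff)
  have "0 \<le> s"
    using s assms(3,4) monoD[OF assms(2), of s 0] by (cases "0 \<le> s") auto
  then obtain k where k: "0 \<le> k" "g k = Q"
    using IVT'[of g 0 Q s] assms(1,3,4) s by (auto intro: continuous_on_subset)
  moreover have "k \<noteq> 0" using k(2) assms(3,4) by auto
  ultimately show ?thesis using that[of k] by simp
qed

section \<open>The spaces of test functions, integrable functions and bounded functions\<close>

lemma grad_unique:
  assumes "(\<phi> has_derivative (\<lambda>h. w \<bullet> h)) (at x)"
  shows "grad \<phi> x = w"
  unfolding grad_def frechet_derivative_at[OF assms, symmetric]
  by (simp add: vec_eq_iff inner_axis)

lemma has_derivative_grad:
  assumes "\<phi> \<in> C1_0 \<Omega>"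
  shows "(\<phi> has_derivative (\<lambda>h. grad \<phi> x \<bullet> h)) (at x)"
proof -
  have "\<phi> differentiable (at x)" using assms by (simp add: C1_0_def)
  then have D: "(\<phi> has_derivative frechet_derivative \<phi> (at x)) (at x)"
    by (simp add: frechet_derivative_works)
  have lin: "linear (frechet_derivative \<phi> (at x))" using D by (rule has_derivative_linear)
  have "frechet_derivative \<phi> (at x) h = grad \<phi> x \<bullet> h" for h
  proof -
    have "h = (\<Sum>k\<in>UNIV. h $ k *\<^sub>R axis k 1)"
      using basis_expansion[of h] by (simp add: scalar_mult_eq_scaleR)
    then have "frechet_derivative \<phi> (at x) h = (\<Sum>k\<in>UNIV. h $ k *\<^sub>R frechet_derivative \<phi> (at x) (axis k 1))"
      using linear_sum[OF lin, of "\<lambda>k. h $ k *\<^sub>R axis k 1" UNIV] linear_cmul[OF lin] by simp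
    then show ?thesis by (simp add: grad_def inner_vec_def mult.commute)
  qed
  then show ?thesis using D by presburger
qed

text \<open>The gradient is unique, so exhibiting a continuous gradient and a compact set that contains the
  support suffices.\<close>

lemma C1_0_I:
  assumes "\<And>x. (\<phi> has_derivative (\<lambda>h. w x \<bullet> h)) (at x)" "continuous_on UNIV w"
    and "\<And>x. \<phi> x \<noteq> 0 \<Longrightarrow> x \<in> S" "compact S" "S \<subseteq> \<Omega>"
  shows "\<phi> \<in> C1_0 \<Omega>" "grad \<phi> = w"
proof -
  show g: "grad \<phi> = w" using grad_unique[OF assms(1)] by (simp add: fun_eq_iff)
  have "closure {x. \<phi> x \<noteq> 0} \<subseteq> S"
    using assms(3,4) by (intro closure_minimal) (auto simp: compact_imp_closed)
  moreover from this have "compact (closure {x. \<phi> x \<noteq> 0})"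
    using compact_Int_closed[OF assms(4), of "closure {x. \<phi> x \<noteq> 0}"] by (simp add: inf_absorb2)
  ultimately show "\<phi> \<in> C1_0 \<Omega>"
    using assms(1,2,5) g unfolding C1_0_def differentiable_def by blast
qed

lemma C1_0_support:
  assumes "\<phi> \<in> C1_0 \<Omega>"
  shows "compact (closure {x. \<phi> x \<noteq> 0})" "closure {x. \<phi> x \<noteq> 0} \<subseteq> \<Omega>"
    "\<phi> x \<noteq> 0 \<Longrightarrow> x \<in> closure {x. \<phi> x \<noteq> 0}" "continuous_on UNIV (grad \<phi>)"
  using assms closure_subset[of "{x. \<phi> x \<noteq> 0}"] by (auto simp: C1_0_def)

lemma C1_0_continuous: "\<phi> \<in> C1_0 \<Omega> \<Longrightarrow> continuous_on UNIV \<phi>"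
  by (intro differentiable_imp_continuous_on) (simp add: C1_0_def differentiable_on_def)

lemma C1_0_zero: "(\<lambda>x. 0) \<in> C1_0 \<Omega>"
  by (rule C1_0_I(1)[where w = "\<lambda>x. 0" and S = "{}"]) simp_all

lemma C1_0_lincomb:
  assumes "\<phi> \<in> C1_0 \<Omega>" "\<psi> \<in> C1_0 \<Omega>"
  shows "(\<lambda>x. \<alpha> * \<phi> x + \<beta> * \<psi> x) \<in> C1_0 \<Omega>"
    "grad (\<lambda>x. \<alpha> * \<phi> x + \<beta> * \<psi> x) = (\<lambda>x. \<alpha> *\<^sub>R grad \<phi> x + \<beta> *\<^sub>R grad \<psi> x)"
proof -
  have d: "((\<lambda>x. \<alpha> * \<phi> x + \<beta> * \<psi> x) has_derivative
      (\<lambda>h. (\<alpha> *\<^sub>R grad \<phi> x + \<beta> *\<^sub>R grad \<psi> x) \<bullet> h)) (at x)" for x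
    by (auto intro!: derivative_eq_intros has_derivative_grad[OF assms(1)] has_derivative_grad[OF assms(2)]
        simp: inner_add_left)
  have c: "continuous_on UNIV (\<lambda>x. \<alpha> *\<^sub>R grad \<phi> x + \<beta> *\<^sub>R grad \<psi> x)"
    using C1_0_support(4)[OF assms(1)] C1_0_support(4)[OF assms(2)] by (intro continuous_intros)
  have s: "x \<in> closure {x. \<phi> x \<noteq> 0} \<union> closure {x. \<psi> x \<noteq> 0}" if "\<alpha> * \<phi> x + \<beta> * \<psi> x \<noteq> 0" for x
    using that C1_0_support(3)[OF assms(1), of x] C1_0_support(3)[OF assms(2), of x]
    by (cases "\<phi> x = 0"; cases "\<psi> x = 0") simp_all
  note * = C1_0_I[where w = "\<lambda>x. \<alpha> *\<^sub>R grad \<phi> x + \<beta> *\<^sub>R grad \<psi> x"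
      and S = "closure {x. \<phi> x \<noteq> 0} \<union> closure {x. \<psi> x \<noteq> 0}", OF d c s]
  show "(\<lambda>x. \<alpha> * \<phi> x + \<beta> * \<psi> x) \<in> C1_0 \<Omega>"
    "grad (\<lambda>x. \<alpha> * \<phi> x + \<beta> * \<psi> x) = (\<lambda>x. \<alpha> *\<^sub>R grad \<phi> x + \<beta> *\<^sub>R grad \<psi> x)"
    using * C1_0_support(1,2)[OF assms(1)] C1_0_support(1,2)[OF assms(2)] by (simp_all add: compact_Un)
qed

lemma C1_0_compose:
  assumes "\<phi> \<in> C1_0 \<Omega>" "\<And>s. (\<theta> has_real_derivative \<theta>' s) (at s)" "continuous_on UNIV \<theta>'" "\<theta> 0 = 0"
  shows "(\<lambda>x. \<theta> (\<phi> x)) \<in> C1_0 \<Omega>" "grad (\<lambda>x. \<theta> (\<phi> x)) = (\<lambda>x. \<theta>' (\<phi> x) *\<^sub>R grad \<phi> x)"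
proof -
  have d: "((\<lambda>x. \<theta> (\<phi> x)) has_derivative (\<lambda>h. (\<theta>' (\<phi> x) *\<^sub>R grad \<phi> x) \<bullet> h)) (at x)" for x
  proof -
    have "(\<theta> has_derivative (*) (\<theta>' (\<phi> x))) (at (\<phi> x))"
      using assms(2) by (rule has_field_derivative_imp_has_derivative)
    from has_derivative_compose[OF has_derivative_grad[OF assms(1)] this]
    show ?thesis by simp
  qed
  have c: "continuous_on UNIV (\<lambda>x. \<theta>' (\<phi> x) *\<^sub>R grad \<phi> x)"
    using C1_0_support(4)[OF assms(1)] C1_0_continuous[OF assms(1)]
    by (intro continuous_on_scaleR continuous_on_compose2[OF assms(3)]) auto
  have s: "x \<in> closure {x. \<phi> x \<noteq> 0}" if "\<theta> (\<phi> x) \<noteq> 0" for x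
    using that assms(4) by (intro C1_0_support(3)[OF assms(1)]) auto
  note * = C1_0_I[where w = "\<lambda>x. \<theta>' (\<phi> x) *\<^sub>R grad \<phi> x", OF d c s C1_0_support(1,2)[OF assms(1)]]
  show "(\<lambda>x. \<theta> (\<phi> x)) \<in> C1_0 \<Omega>" "grad (\<lambda>x. \<theta> (\<phi> x)) = (\<lambda>x. \<theta>' (\<phi> x) *\<^sub>R grad \<phi> x)"
    using * by simp_all
qed

lemma locally_lipschitz_continuous:
  assumes "locally_lipschitz c"
  shows "continuous_on UNIV c"
proof -
  have "isCont c x" for x
  proof -
    obtain r L where "r > 0" "L-lipschitz_on (ball x r) c"
      using assms unfolding locally_lipschitz_def by blast
    then have "continuous_on (ball x r) c" "x \<in> ball x r"
      by (auto intro: lipschitz_on_continuous_on)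
    then show ?thesis using continuous_on_eq_continuous_at[OF open_ball] by blast
  qed
  then show ?thesis by (simp add: continuous_on_eq_continuous_at)
qed

text \<open>A continuous function is bounded on the compact closure of the domain.\<close>

lemma integrable_continuous_bounded_domain:
  fixes h :: "'a::euclidean_space \<Rightarrow> real"
  assumes "open \<Omega>" "bounded \<Omega>" "continuous_on UNIV h"
  shows "integrable (lebesgue_on \<Omega>) h"
proof -
  have lm: "\<Omega> \<in> lmeasurable" using assms(1,2) by (simp add: lmeasurable_open)
  interpret finite_measure "lebesgue_on \<Omega>"
    using lm by (rule finite_measure_lebesgue_on)
  have "compact (h ` closure \<Omega>)"
    using assms by (intro compact_continuous_image continuous_on_subset[OF assms(3)]) auto
  then obtain M where "\<forall>y\<in>h ` closure \<Omega>. norm y \<le> M"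
    using compact_imp_bounded bounded_iff by blast
  then have "AE x in lebesgue_on \<Omega>. norm (h x) \<le> M"
    using closure_subset[of \<Omega>] by (intro AE_I2) auto
  moreover have "h \<in> borel_measurable (lebesgue_on \<Omega>)"
    using assms lm by (intro continuous_imp_measurable_on_sets_lebesgue continuous_on_subset[OF assms(3)]) auto
  ultimately show ?thesis by (rule integrable_const_bound)
qed

lemma integrable_mult_bounded:
  fixes a h :: "'a \<Rightarrow> real"
  assumes "integrable M a" "h \<in> borel_measurable M" "AE x in M. \<bar>h x\<bar> \<le> R"
  shows "integrable M (\<lambda>x. a x * h x)"
proof (rule Bochner_Integration.integrable_bound)
  show "integrable M (\<lambda>x. R * a x)" using assms(1) by simp
  show "(\<lambda>x. a x * h x) \<in> borel_measurable M" using assms(1,2) by measurable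
  show "AE x in M. norm (a x * h x) \<le> norm (R * a x)"
    using assms(3)
  proof eventually_elim
    case (elim x)
    then have "\<bar>h x\<bar> * \<bar>a x\<bar> \<le> \<bar>R\<bar> * \<bar>a x\<bar>" by (intro mult_right_mono) auto
    then show ?case by (simp add: abs_mult mult.commute)
  qed
qed

lemma in_Linf_AE_bounded:
  assumes "in_Linf \<Omega> u"
  obtains M where "0 \<le> M" "AE x in lebesgue_on \<Omega>. \<bar>u x\<bar> \<le> M"
proof -
  let ?e = "esssup (lebesgue_on \<Omega>) (\<lambda>x. ereal \<bar>u x\<bar>)"
  have "?e < \<infinity>" using assms by (simp add: in_Linf_def Linf_norm_def)
  then obtain M where M: "?e \<le> ereal M" by (cases ?e) auto
  have "AE x in lebesgue_on \<Omega>. \<bar>u x\<bar> \<le> max M 0"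
    using esssup_AE[of "\<lambda>x. ereal \<bar>u x\<bar>" "lebesgue_on \<Omega>"]
  proof eventually_elim
    case (elim x)
    then have "ereal \<bar>u x\<bar> \<le> ereal M" using M by (rule order_trans)
    then show ?case by simp
  qed
  then show ?thesis using that[of "max M 0"] by simp
qed

lemma AE_bounded_Linf:
  assumes "u \<in> borel_measurable (lebesgue_on \<Omega>)" "AE x in lebesgue_on \<Omega>. \<bar>u x\<bar> \<le> M"
  shows "in_Linf \<Omega> u" "Linf_norm \<Omega> u \<le> ereal M"
proof -
  show le: "Linf_norm \<Omega> u \<le> ereal M"
    unfolding Linf_norm_def using assms by (intro esssup_I) auto
  show "in_Linf \<Omega> u"
    unfolding in_Linf_def using assms(1) le_less_trans[OF le, of \<infinity>] by simp
qed

section \<open>The energy form of the operator\<close>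

locale X_elliptic_operator =
  fixes \<Omega> :: "(real^'n) set"
    and X :: "'m::finite \<Rightarrow> real^'n \<Rightarrow> real^'n"
    and B :: "real^'n \<Rightarrow> real^'n^'n"
  assumes open_dom: "open \<Omega>" and bounded_dom: "bounded \<Omega>"
    and X_lipschitz: "\<And>j k. locally_lipschitz (\<lambda>x. X j x $ k)"
    and B_measurable: "\<And>i j. (\<lambda>x. B x $ i $ j) \<in> borel_measurable lebesgue"
    and B_sym: "\<And>x i j. B x $ i $ j = B x $ j $ i"
    and elliptic: "X_elliptic \<Omega> X B"
    and embedding: "assumption_S \<Omega> X"
begin

definition form :: "(real^'n \<Rightarrow> real) \<Rightarrow> (real^'n \<Rightarrow> real) \<Rightarrow> real" where
  "form \<phi> \<psi> = (LINT x|lebesgue_on \<Omega>. (B x *v grad \<phi> x) \<bullet> grad \<psi> x)"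

lemma integrable_continuous: "continuous_on UNIV h \<Longrightarrow> integrable (lebesgue_on \<Omega>) h"
  for h :: "real^'n \<Rightarrow> real"
  using open_dom bounded_dom by (rule integrable_continuous_bounded_domain)

lemma measurable_continuous: "continuous_on UNIV h \<Longrightarrow> h \<in> borel_measurable (lebesgue_on \<Omega>)"
  for h :: "real^'n \<Rightarrow> real"
  using integrable_continuous by (rule borel_measurable_integrable)

lemma X_continuous: "continuous_on UNIV (X j)"
  using locally_lipschitz_continuous[OF X_lipschitz]
    continuous_on_vec_lambda[of UNIV "\<lambda>k x. X j x $ k"] by simp

lemma quadratic_form: "(B x *v \<xi>) \<bullet> \<xi> = (\<Sum>i\<in>UNIV. \<Sum>j\<in>UNIV. B x $ i $ j * \<xi> $ i * \<xi> $ j)"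
  by (simp add: inner_vec_def matrix_vector_mult_def sum_distrib_left mult_ac)

lemma B_commute: "(B x *v \<xi>) \<bullet> \<eta> = (B x *v \<eta>) \<bullet> \<xi>"
proof -
  have "(B x *v \<xi>) \<bullet> \<eta> = (\<Sum>i\<in>UNIV. \<Sum>j\<in>UNIV. B x $ i $ j * \<xi> $ j * \<eta> $ i)"
    by (simp add: inner_vec_def matrix_vector_mult_def sum_distrib_right)
  also have "\<dots> = (\<Sum>j\<in>UNIV. \<Sum>i\<in>UNIV. B x $ j $ i * \<eta> $ i * \<xi> $ j)"
    by (subst sum.swap, intro sum.cong refl) (metis B_sym mult.assoc mult.commute)
  also have "\<dots> = (B x *v \<eta>) \<bullet> \<xi>"
    by (simp add: inner_vec_def matrix_vector_mult_def sum_distrib_right)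
  finally show ?thesis .
qed

lemma ellipticity:
  obtains \<Lambda> where "\<Lambda> > 0"
    "\<And>x \<xi>. x \<in> \<Omega> \<Longrightarrow> (\<Sum>j\<in>UNIV. (X j x \<bullet> \<xi>)\<^sup>2) \<le> \<Lambda> * ((B x *v \<xi>) \<bullet> \<xi>)"
    "\<And>x \<xi>. x \<in> \<Omega> \<Longrightarrow> (B x *v \<xi>) \<bullet> \<xi> \<le> \<Lambda> * (\<Sum>j\<in>UNIV. (X j x \<bullet> \<xi>)\<^sup>2)"
proof -
  obtain \<Lambda> where "\<Lambda> > 0" and \<Lambda>: "\<And>x \<xi>. x \<in> \<Omega> \<Longrightarrow>
      1 / \<Lambda> * (\<Sum>j\<in>UNIV. (X j x \<bullet> \<xi>)\<^sup>2) \<le> (B x *v \<xi>) \<bullet> \<xi> \<and>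
      (B x *v \<xi>) \<bullet> \<xi> \<le> \<Lambda> * (\<Sum>j\<in>UNIV. (X j x \<bullet> \<xi>)\<^sup>2)"
    using elliptic unfolding X_elliptic_def quadratic_form by blast
  then show ?thesis
    using that[of \<Lambda>] by (auto simp: field_simps)
qed

lemma B_nonneg:
  assumes "x \<in> \<Omega>"
  shows "0 \<le> (B x *v \<xi>) \<bullet> \<xi>"
proof -
  obtain \<Lambda> where "\<Lambda> > 0" "(\<Sum>j\<in>UNIV. (X j x \<bullet> \<xi>)\<^sup>2) \<le> \<Lambda> * ((B x *v \<xi>) \<bullet> \<xi>)"
    using ellipticity assms by metis
  moreover have "0 \<le> (\<Sum>j\<in>UNIV. (X j x \<bullet> \<xi>)\<^sup>2)" by (simp add: sum_nonneg)
  ultimately have "0 \<le> \<Lambda> * ((B x *v \<xi>) \<bullet> \<xi>)" by linarith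
  then show ?thesis using \<open>\<Lambda> > 0\<close> by (simp add: zero_le_mult_iff)
qed

text \<open>A semidefinite form satisfies \<open>2 \<bar>B\<xi>\<cdot>\<eta>\<bar> \<le> B\<xi>\<cdot>\<xi> + B\<eta>\<cdot>\<eta>\<close>. By ellipticity the right-hand side is bounded by
  continuous functions, although the coefficients of \<open>B\<close> are merely measurable.\<close>

lemma form_integrable:
  assumes "\<phi> \<in> C1_0 \<Omega>" "\<psi> \<in> C1_0 \<Omega>"
  shows "integrable (lebesgue_on \<Omega>) (\<lambda>x. (B x *v grad \<phi> x) \<bullet> grad \<psi> x)"
proof -
  obtain \<Lambda> where \<Lambda>: "\<Lambda> > 0"
    "\<And>x \<xi>. x \<in> \<Omega> \<Longrightarrow> (B x *v \<xi>) \<bullet> \<xi> \<le> \<Lambda> * (\<Sum>j\<in>UNIV. (X j x \<bullet> \<xi>)\<^sup>2)"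
    using ellipticity by metis
  note gc = C1_0_support(4)[OF assms(1)] C1_0_support(4)[OF assms(2)]
  define b where "b x = \<Lambda> * ((\<Sum>j\<in>UNIV. (X j x \<bullet> grad \<phi> x)\<^sup>2) + (\<Sum>j\<in>UNIV. (X j x \<bullet> grad \<psi> x)\<^sup>2))" for x
  have "continuous_on UNIV b"
    unfolding b_def using gc X_continuous by (intro continuous_intros)
  show ?thesis
  proof (rule Bochner_Integration.integrable_bound)
    show "integrable (lebesgue_on \<Omega>) b" using \<open>continuous_on UNIV b\<close> by (rule integrable_continuous)
    have B_m: "(\<lambda>x. B x $ i $ j) \<in> borel_measurable (lebesgue_on \<Omega>)" for i j
      using B_measurable by (rule measurable_restrict_space1)
    have grad_m: "(\<lambda>x. grad \<phi> x $ i) \<in> borel_measurable (lebesgue_on \<Omega>)"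
      "(\<lambda>x. grad \<psi> x $ i) \<in> borel_measurable (lebesgue_on \<Omega>)" for i
      using gc by (simp_all add: measurable_continuous continuous_on_component)
    have "(\<lambda>x. \<Sum>i\<in>UNIV. (\<Sum>j\<in>UNIV. B x $ i $ j * grad \<phi> x $ j) * grad \<psi> x $ i) \<in> borel_measurable (lebesgue_on \<Omega>)"
      using B_m grad_m by (intro borel_measurable_sum borel_measurable_times)
    then show "(\<lambda>x. (B x *v grad \<phi> x) \<bullet> grad \<psi> x) \<in> borel_measurable (lebesgue_on \<Omega>)"
      by (simp add: inner_vec_def matrix_vector_mult_def)
    show "AE x in lebesgue_on \<Omega>. norm ((B x *v grad \<phi> x) \<bullet> grad \<psi> x) \<le> norm (b x)"
    proof (rule AE_I2)
      fix x assume "x \<in> space (lebesgue_on \<Omega>)"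
      then have x: "x \<in> \<Omega>" by simp
      let ?p = "grad \<phi> x" and ?q = "grad \<psi> x"
      have "0 \<le> (B x *v (?p - ?q)) \<bullet> (?p - ?q)" "0 \<le> (B x *v (?p + ?q)) \<bullet> (?p + ?q)"
        using x by (simp_all add: B_nonneg)
      moreover have "(B x *v (?p - ?q)) \<bullet> (?p - ?q)
          = (B x *v ?p) \<bullet> ?p - 2 * ((B x *v ?p) \<bullet> ?q) + (B x *v ?q) \<bullet> ?q"
        by (simp add: matrix_vector_mult_diff_distrib inner_diff_left inner_diff_right B_commute[of x ?q ?p])
      moreover have "(B x *v (?p + ?q)) \<bullet> (?p + ?q)
          = (B x *v ?p) \<bullet> ?p + 2 * ((B x *v ?p) \<bullet> ?q) + (B x *v ?q) \<bullet> ?q"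
        by (simp add: matrix_vector_right_distrib inner_add_left inner_add_right B_commute[of x ?q ?p])
      ultimately have "2 * \<bar>(B x *v ?p) \<bullet> ?q\<bar> \<le> (B x *v ?p) \<bullet> ?p + (B x *v ?q) \<bullet> ?q"
        by linarith
      moreover have "0 \<le> (B x *v ?p) \<bullet> ?p" "0 \<le> (B x *v ?q) \<bullet> ?q" using x by (simp_all add: B_nonneg)
      moreover have "(B x *v ?p) \<bullet> ?p + (B x *v ?q) \<bullet> ?q \<le> b x"
        using \<Lambda>(2)[OF x, of ?p] \<Lambda>(2)[OF x, of ?q] by (simp add: b_def distrib_left)
      ultimately show "norm ((B x *v ?p) \<bullet> ?q) \<le> norm (b x)"
        unfolding real_norm_def by linarith
    qed
  qed
qed

sublocale psd_form "C1_0 \<Omega>" form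
proof
  show "(\<lambda>x. \<alpha> * \<phi> x + \<beta> * \<psi> x) \<in> C1_0 \<Omega>" if "\<phi> \<in> C1_0 \<Omega>" "\<psi> \<in> C1_0 \<Omega>" for \<phi> \<psi> \<alpha> \<beta>
    using that by (rule C1_0_lincomb)
  show "form (\<lambda>x. \<alpha> * \<phi> x + \<beta> * \<psi> x) \<eta> = \<alpha> * form \<phi> \<eta> + \<beta> * form \<psi> \<eta>"
    if "\<phi> \<in> C1_0 \<Omega>" "\<psi> \<in> C1_0 \<Omega>" "\<eta> \<in> C1_0 \<Omega>" for \<phi> \<psi> \<eta> \<alpha> \<beta>
    using form_integrable that
    by (simp add: form_def C1_0_lincomb matrix_vector_right_distrib matrix_vector_mult_scaleR inner_add_left)
  show "form \<phi> \<psi> = form \<psi> \<phi>" for \<phi> \<psi>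
    unfolding form_def by (rule Bochner_Integration.integral_cong) (simp_all add: B_commute)
  show "0 \<le> form \<phi> \<phi>" for \<phi>
    unfolding form_def by (rule Bochner_Integration.integral_nonneg) (simp add: B_nonneg)
qed

text \<open>The gradient of \<open>\<theta> \<circ> \<phi>\<close> is \<open>\<theta>'(\<phi>) \<nabla>\<phi>\<close>, and \<open>\<theta>'(\<phi>)\<^sup>2 \<le> 1\<close>.\<close>

lemma form_compose_le:
  assumes "\<phi> \<in> C1_0 \<Omega>" "\<And>s. (\<theta> has_real_derivative \<theta>' s) (at s)" "continuous_on UNIV \<theta>'" "\<theta> 0 = 0"
    and "\<And>s. 0 \<le> \<theta>' s" "\<And>s. \<theta>' s \<le> 1"
  shows "form (\<lambda>x. \<theta> (\<phi> x)) (\<lambda>x. \<theta> (\<phi> x)) \<le> form \<phi> \<phi>"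
proof -
  note comp = C1_0_compose[OF assms(1-4)]
  show ?thesis
    unfolding form_def
  proof (rule integral_mono)
    show "(B x *v grad (\<lambda>x. \<theta> (\<phi> x)) x) \<bullet> grad (\<lambda>x. \<theta> (\<phi> x)) x \<le> (B x *v grad \<phi> x) \<bullet> grad \<phi> x"
      if "x \<in> space (lebesgue_on \<Omega>)" for x
    proof -
      have "(\<theta>' (\<phi> x))\<^sup>2 * ((B x *v grad \<phi> x) \<bullet> grad \<phi> x) \<le> 1 * ((B x *v grad \<phi> x) \<bullet> grad \<phi> x)"
        using that assms(5,6) by (intro mult_right_mono B_nonneg power_le_one) auto
      then show ?thesis by (simp add: comp matrix_vector_mult_scaleR power2_eq_square mult.assoc)
    qed
  qed (use form_integrable comp(1) assms(1) in auto)
qed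

text \<open>Uniform ellipticity, integrated. It lets the completion be described by the energy norm alone.\<close>

lemma X_norm_equiv:
  obtains c where "c > 0" "\<And>\<phi>. \<phi> \<in> C1_0 \<Omega> \<Longrightarrow> X_norm \<Omega> X \<phi> \<le> c * nrm \<phi>"
    "\<And>\<phi>. \<phi> \<in> C1_0 \<Omega> \<Longrightarrow> nrm \<phi> \<le> c * X_norm \<Omega> X \<phi>"
proof -
  obtain \<Lambda> where \<Lambda>: "\<Lambda> > 0"
    "\<And>x \<xi>. x \<in> \<Omega> \<Longrightarrow> (\<Sum>j\<in>UNIV. (X j x \<bullet> \<xi>)\<^sup>2) \<le> \<Lambda> * ((B x *v \<xi>) \<bullet> \<xi>)"
    "\<And>x \<xi>. x \<in> \<Omega> \<Longrightarrow> (B x *v \<xi>) \<bullet> \<xi> \<le> \<Lambda> * (\<Sum>j\<in>UNIV. (X j x \<bullet> \<xi>)\<^sup>2)"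
    by (rule ellipticity) (rule that)
  have eq: "X_grad X \<phi> x \<bullet> X_grad X \<phi> x = (\<Sum>j\<in>UNIV. (X j x \<bullet> grad \<phi> x)\<^sup>2)" for \<phi> x
    by (simp add: X_grad_def inner_vec_def power2_eq_square)
  have int: "integrable (lebesgue_on \<Omega>) (\<lambda>x. \<Sum>j\<in>UNIV. (X j x \<bullet> grad \<phi> x)\<^sup>2)"
    if "\<phi> \<in> C1_0 \<Omega>" for \<phi>
    using C1_0_support(4)[OF that] X_continuous by (intro integrable_continuous continuous_intros)
  have 1: "X_inner \<Omega> X \<phi> \<phi> \<le> \<Lambda> * form \<phi> \<phi>" if "\<phi> \<in> C1_0 \<Omega>" for \<phi>
  proof -
    have "X_inner \<Omega> X \<phi> \<phi> \<le> (LINT x|lebesgue_on \<Omega>. \<Lambda> * ((B x *v grad \<phi> x) \<bullet> grad \<phi> x))"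
      unfolding X_inner_def eq using \<Lambda>(2) int[OF that] form_integrable[OF that that]
      by (intro integral_mono) auto
    then show ?thesis by (simp add: form_def)
  qed
  have 2: "form \<phi> \<phi> \<le> \<Lambda> * X_inner \<Omega> X \<phi> \<phi>" if "\<phi> \<in> C1_0 \<Omega>" for \<phi>
  proof -
    have "form \<phi> \<phi> \<le> (LINT x|lebesgue_on \<Omega>. \<Lambda> * (\<Sum>j\<in>UNIV. (X j x \<bullet> grad \<phi> x)\<^sup>2))"
      unfolding form_def using \<Lambda>(3) int[OF that] form_integrable[OF that that]
      by (intro integral_mono) auto
    then show ?thesis unfolding X_inner_def eq by simp
  qed
  show ?thesis
  proof (rule that[of "sqrt \<Lambda>"])
    show "sqrt \<Lambda> > 0" using \<Lambda> by simp
    show "X_norm \<Omega> X \<phi> \<le> sqrt \<Lambda> * nrm \<phi>" if "\<phi> \<in> C1_0 \<Omega>" for \<phi>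
      using 1[OF that] by (simp add: X_norm_def nrm_def flip: real_sqrt_mult)
    show "nrm \<phi> \<le> sqrt \<Lambda> * X_norm \<Omega> X \<phi>" if "\<phi> \<in> C1_0 \<Omega>" for \<phi>
      using 2[OF that] by (simp add: X_norm_def nrm_def flip: real_sqrt_mult)
  qed
qed

lemma X_Cauchy_iff: "X_Cauchy \<Omega> X \<Phi> \<longleftrightarrow> cauchy \<Phi>"
proof -
  obtain c where c: "c > 0" "\<And>\<phi>. \<phi> \<in> C1_0 \<Omega> \<Longrightarrow> X_norm \<Omega> X \<phi> \<le> c * nrm \<phi>"
    "\<And>\<phi>. \<phi> \<in> C1_0 \<Omega> \<Longrightarrow> nrm \<phi> \<le> c * X_norm \<Omega> X \<phi>"
    by (rule X_norm_equiv) (rule that)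
  have dominated: "\<forall>e>0. \<exists>M. \<forall>m\<ge>M. \<forall>n\<ge>M. N2 (\<lambda>x. \<Phi> m x - \<Phi> n x) < e"
    if le: "\<And>\<phi>. \<phi> \<in> C1_0 \<Omega> \<Longrightarrow> N2 \<phi> \<le> c * N1 \<phi>" and mem: "\<And>n. \<Phi> n \<in> C1_0 \<Omega>"
      and lim: "\<forall>e>0. \<exists>M. \<forall>m\<ge>M. \<forall>n\<ge>M. N1 (\<lambda>x. \<Phi> m x - \<Phi> n x) < e"
    for N1 N2 :: "(real^'n \<Rightarrow> real) \<Rightarrow> real"
  proof (intro allI impI)
    fix e :: real assume "e > 0"
    then have "e / c > 0" using c by simp
    then obtain M where M: "\<And>m n. m \<ge> M \<Longrightarrow> n \<ge> M \<Longrightarrow> N1 (\<lambda>x. \<Phi> m x - \<Phi> n x) < e / c"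
      using lim by blast
    have "N2 (\<lambda>x. \<Phi> m x - \<Phi> n x) < e" if "m \<ge> M" "n \<ge> M" for m n
      using le[OF diff_in[OF mem mem], of m n] M[OF that] c(1) by (simp add: field_simps)
    then show "\<exists>M. \<forall>m\<ge>M. \<forall>n\<ge>M. N2 (\<lambda>x. \<Phi> m x - \<Phi> n x) < e" by blast
  qed
  show ?thesis
  proof
    assume "X_Cauchy \<Omega> X \<Phi>"
    then have m: "\<And>n. \<Phi> n \<in> C1_0 \<Omega>"
      and l: "\<forall>e>0. \<exists>M. \<forall>m\<ge>M. \<forall>n\<ge>M. X_norm \<Omega> X (\<lambda>x. \<Phi> m x - \<Phi> n x) < e"
      by (simp_all add: X_Cauchy_def)
    show "cauchy \<Phi>"
      unfolding cauchy_def by (rule conjI, rule allI, rule m, rule dominated[OF c(3) m l])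
  next
    assume "cauchy \<Phi>"
    then have m: "\<And>n. \<Phi> n \<in> C1_0 \<Omega>"
      and l: "\<forall>e>0. \<exists>M. \<forall>m\<ge>M. \<forall>n\<ge>M. nrm (\<lambda>x. \<Phi> m x - \<Phi> n x) < e"
      by (simp_all add: cauchy_def)
    show "X_Cauchy \<Omega> X \<Phi>"
      unfolding X_Cauchy_def by (rule conjI, rule allI, rule m, rule dominated[OF c(2) m l])
  qed
qed

lemma X_norm_tendsto_0_iff:
  assumes "\<And>n. \<Phi> n \<in> C1_0 \<Omega>"
  shows "(\<lambda>n. X_norm \<Omega> X (\<Phi> n)) \<longlonglongrightarrow> 0 \<longleftrightarrow> (\<lambda>n. nrm (\<Phi> n)) \<longlonglongrightarrow> 0"
proof -
  obtain c where c: "c > 0" "\<And>\<phi>. \<phi> \<in> C1_0 \<Omega> \<Longrightarrow> X_norm \<Omega> X \<phi> \<le> c * nrm \<phi>"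
    "\<And>\<phi>. \<phi> \<in> C1_0 \<Omega> \<Longrightarrow> nrm \<phi> \<le> c * X_norm \<Omega> X \<phi>"
    by (rule X_norm_equiv) (rule that)
  have nn: "0 \<le> nrm (\<Phi> n)" for n using assms by (rule nrm_nonneg)
  then have nX: "0 \<le> X_norm \<Omega> X (\<Phi> n)" for n
    using c(1) c(3)[OF assms, of n] by (meson order_trans zero_le_mult_iff not_less)
  show ?thesis
  proof
    assume "(\<lambda>n. X_norm \<Omega> X (\<Phi> n)) \<longlonglongrightarrow> 0"
    then have "(\<lambda>n. c * X_norm \<Omega> X (\<Phi> n)) \<longlonglongrightarrow> 0" by (rule tendsto_mult_right_zero)
    then show "(\<lambda>n. nrm (\<Phi> n)) \<longlonglongrightarrow> 0"
      by (rule Lim_null_comparison[rotated]) (use c(3) assms nn in auto)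
  next
    assume "(\<lambda>n. nrm (\<Phi> n)) \<longlonglongrightarrow> 0"
    then have "(\<lambda>n. c * nrm (\<Phi> n)) \<longlonglongrightarrow> 0" by (rule tendsto_mult_right_zero)
    then show "(\<lambda>n. X_norm \<Omega> X (\<Phi> n)) \<longlonglongrightarrow> 0"
      by (rule Lim_null_comparison[rotated]) (use c(2) assms nX in auto)
  qed
qed

section \<open>The completion and its elements as functions\<close>

definition equivalent :: "((nat \<Rightarrow> real^'n \<Rightarrow> real) \<times> (nat \<Rightarrow> real^'n \<Rightarrow> real)) set" where
  "equivalent = {(\<Phi>, \<Psi>). cauchy \<Phi> \<and> cauchy \<Psi> \<and> (\<lambda>n. nrm (\<lambda>x. \<Phi> n x - \<Psi> n x)) \<longlonglongrightarrow> 0}"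

definition cls :: "(nat \<Rightarrow> real^'n \<Rightarrow> real) \<Rightarrow> 'n hx" where
  "cls \<Phi> = equivalent `` {\<Phi>}"

text \<open>Equivalent norms have the same Cauchy sequences and the same null sequences.\<close>

lemma HX_eq: "HX \<Omega> X = Collect cauchy // equivalent"
proof -
  have "{(\<Phi>, \<Psi>). X_Cauchy \<Omega> X \<Phi> \<and> X_Cauchy \<Omega> X \<Psi> \<and>
        (\<lambda>n. X_norm \<Omega> X (\<lambda>x. \<Phi> n x - \<Psi> n x)) \<longlonglongrightarrow> 0} = equivalent"
    unfolding equivalent_def X_Cauchy_iff
    by (auto simp: X_norm_tendsto_0_iff cauchy_in diff_in)
  then show ?thesis unfolding HX_def X_Cauchy_iff by simp
qed

lemma equivalent_refl: "refl_on (Collect cauchy) equivalent"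
  proof (rule refl_onI)
    fix \<Phi> assume "\<Phi> \<in> Collect cauchy"
    then have c: "cauchy \<Phi>" by simp
    have "nrm (\<lambda>x. 0) = 0"
      using form_expand[OF C1_0_zero C1_0_zero, of 0 0]
      unfolding nrm_def mult_zero_left mult_zero_right add_0_right power_zero_numeral
      by (simp only: real_sqrt_zero)
    then show "(\<Phi>, \<Phi>) \<in> equivalent" using c by (simp add: equivalent_def)
  qed

lemma equivalent_sym: "sym equivalent"
  proof (rule symI)
    fix \<Phi> \<Psi> assume *: "(\<Phi>, \<Psi>) \<in> equivalent"
    then have "nrm (\<lambda>x. \<Psi> n x - \<Phi> n x) = nrm (\<lambda>x. \<Phi> n x - \<Psi> n x)" for n
      by (intro nrm_diff_commute) (auto simp: equivalent_def cauchy_in)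
    then show "(\<Psi>, \<Phi>) \<in> equivalent" using * by (simp add: equivalent_def)
  qed

lemma equivalent_trans: "trans equivalent"
  proof (rule transI)
    fix \<Phi> \<Psi> \<Upsilon> assume *: "(\<Phi>, \<Psi>) \<in> equivalent" "(\<Psi>, \<Upsilon>) \<in> equivalent"
    then have c: "cauchy \<Phi>" "cauchy \<Psi>" "cauchy \<Upsilon>"
      and l: "(\<lambda>n. nrm (\<lambda>x. \<Phi> n x - \<Psi> n x)) \<longlonglongrightarrow> 0" "(\<lambda>n. nrm (\<lambda>x. \<Psi> n x - \<Upsilon> n x)) \<longlonglongrightarrow> 0"
      unfolding equivalent_def by simp_all
    have le: "norm (nrm (\<lambda>x. \<Phi> n x - \<Upsilon> n x)) \<le> nrm (\<lambda>x. \<Phi> n x - \<Psi> n x) + nrm (\<lambda>x. \<Psi> n x - \<Upsilon> n x)" for n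
    proof -
      have C: "\<Phi> n \<in> C1_0 \<Omega>" "\<Psi> n \<in> C1_0 \<Omega>" "\<Upsilon> n \<in> C1_0 \<Omega>"
        by (rule cauchy_in[OF c(1)], rule cauchy_in[OF c(2)], rule cauchy_in[OF c(3)])
      show ?thesis
        unfolding real_norm_def abs_of_nonneg[OF nrm_nonneg[OF diff_in[OF C(1,3)]]]
        by (rule nrm_diff_triangle[OF C])
    qed
    have "(\<lambda>n. nrm (\<lambda>x. \<Phi> n x - \<Psi> n x) + nrm (\<lambda>x. \<Psi> n x - \<Upsilon> n x)) \<longlonglongrightarrow> 0"
      using tendsto_add[OF l] by simp
    then have "(\<lambda>n. nrm (\<lambda>x. \<Phi> n x - \<Upsilon> n x)) \<longlonglongrightarrow> 0"
      by (rule Lim_null_comparison[OF always_eventually[OF allI[OF le]]])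
    then show "(\<Phi>, \<Upsilon>) \<in> equivalent" using c by (simp add: equivalent_def)
  qed

lemma equivalent_equiv: "equiv (Collect cauchy) equivalent"
proof (rule equivI)
  show "equivalent \<subseteq> Collect cauchy \<times> Collect cauchy"
    by (auto simp: equivalent_def)
qed (rule equivalent_refl equivalent_sym equivalent_trans)+

lemma cls_in_HX: "cauchy \<Phi> \<Longrightarrow> cls \<Phi> \<in> HX \<Omega> X"
  unfolding HX_eq cls_def by (rule quotientI) simp

lemma mem_cls: "cauchy \<Phi> \<Longrightarrow> \<Phi> \<in> cls \<Phi>"
  unfolding cls_def using equiv_class_self[OF equivalent_equiv] by simp

lemma cls_eqI:
  assumes "cauchy \<Phi>" "cauchy \<Psi>" "(\<lambda>n. nrm (\<lambda>x. \<Phi> n x - \<Psi> n x)) \<longlonglongrightarrow> 0"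
  shows "cls \<Phi> = cls \<Psi>"
  unfolding cls_def by (rule equiv_class_eq[OF equivalent_equiv]) (simp add: equivalent_def assms)

lemma HX_mem:
  assumes "U \<in> HX \<Omega> X" "\<Phi> \<in> U"
  shows "cauchy \<Phi>" "cls \<Phi> = U"
proof -
  obtain \<Psi> where \<Psi>: "U = equivalent `` {\<Psi>}" "cauchy \<Psi>"
    using assms(1) unfolding HX_eq by (auto elim: quotientE)
  then have "(\<Psi>, \<Phi>) \<in> equivalent" using assms(2) by simp
  then show "cauchy \<Phi>" "cls \<Phi> = U"
    using equiv_class_eq[OF equivalent_equiv, of \<Psi> \<Phi>] \<Psi> by (simp_all add: cls_def equivalent_def)
qed

lemma HX_obtain:
  assumes "U \<in> HX \<Omega> X"
  obtains \<Phi> where "\<Phi> \<in> U" "cauchy \<Phi>"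
proof -
  obtain \<Psi> where "U = equivalent `` {\<Psi>}" "cauchy \<Psi>"
    using assms unfolding HX_eq by (auto elim: quotientE)
  then show ?thesis using that[of \<Psi>] mem_cls by (simp add: cls_def)
qed

lemma subseq_in_class:
  assumes "U \<in> HX \<Omega> X" "\<Phi> \<in> U" "strict_mono r"
  shows "\<Phi> \<circ> r \<in> U"
proof -
  note c = HX_mem[OF assms(1,2)]
  have "cls \<Phi> = cls (\<Phi> \<circ> r)" using cauchy_subseq[OF c(1) assms(3)] c(1) by (intro cls_eqI)
  then show ?thesis using mem_cls[OF cauchy_subseq(1)[OF c(1) assms(3)]] c(2) by simp
qed

lemma L_form_limit:
  assumes "U \<in> HX \<Omega> X" "V \<in> HX \<Omega> X" "\<Phi> \<in> U" "\<Psi> \<in> V"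
  shows "(\<lambda>n. form (\<Phi> n) (\<Psi> n)) \<longlonglongrightarrow> L_form \<Omega> B U V"
proof -
  have c: "cauchy \<Phi>" "cauchy \<Psi>" using HX_mem assms by blast+
  obtain l where l: "(\<lambda>n. form (\<Phi> n) (\<Psi> n)) \<longlonglongrightarrow> l"
    using form_convergent[OF c] by (auto simp: convergent_def)
  have all: "\<forall>\<Phi>'\<in>U. \<forall>\<Psi>'\<in>V. (\<lambda>n. form (\<Phi>' n) (\<Psi>' n)) \<longlonglongrightarrow> l"
  proof (intro ballI)
    fix \<Phi>' \<Psi>' assume "\<Phi>' \<in> U" "\<Psi>' \<in> V"
    then have "cls \<Phi>' = U" "cls \<Psi>' = V" "cauchy \<Phi>'" "cauchy \<Psi>'" using HX_mem assms(1,2) by blast+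
    then have "(\<Phi>', \<Phi>) \<in> equivalent" "(\<Psi>', \<Psi>) \<in> equivalent"
      using assms(3,4) by (auto simp: cls_def)
    then show "(\<lambda>n. form (\<Phi>' n) (\<Psi>' n)) \<longlonglongrightarrow> l"
      using form_limit_cong[OF c _ _ _ _ l] by (simp add: equivalent_def)
  qed
  have "L_form \<Omega> B U V = l"
    unfolding L_form_def bilinear_extension_def form_def[symmetric]
  proof (rule the_equality)
    show "\<forall>\<Phi>\<in>U. \<forall>\<Psi>\<in>V. (\<lambda>n. form (\<Phi> n) (\<Psi> n)) \<longlonglongrightarrow> l" by (rule all)
    show "l' = l" if "\<forall>\<Phi>\<in>U. \<forall>\<Psi>\<in>V. (\<lambda>n. form (\<Phi> n) (\<Psi> n)) \<longlonglongrightarrow> l'" for l'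
      using that assms(3,4) l LIMSEQ_unique by blast
  qed
  then show ?thesis using l by simp
qed

lemma fun_of_represents:
  assumes "U \<in> HX \<Omega> X"
  shows "integrable (lebesgue_on \<Omega>) (fun_of \<Omega> U)"
    "\<Phi> \<in> U \<Longrightarrow> (\<lambda>n. LINT x|lebesgue_on \<Omega>. \<bar>\<Phi> n x - fun_of \<Omega> U x\<bar>) \<longlonglongrightarrow> 0"
proof -
  have "\<forall>U\<in>HX \<Omega> X. \<exists>u. represents \<Omega> U u"
    using embedding unfolding assumption_S_def by (rule conjunct1)
  then have "\<exists>u. represents \<Omega> U u" using assms by (rule bspec)
  then have r: "represents \<Omega> U (fun_of \<Omega> U)"
    unfolding fun_of_def by (rule someI_ex)
  then have "integrable (lebesgue_on \<Omega>) (\<lambda>x. \<bar>fun_of \<Omega> U x\<bar>)" "fun_of \<Omega> U \<in> borel_measurable (lebesgue_on \<Omega>)"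
    by (simp_all add: represents_def in_Lp_def)
  then show "integrable (lebesgue_on \<Omega>) (fun_of \<Omega> U)"
    by (rule integrable_abs_cancel)
  show "(\<lambda>n. LINT x|lebesgue_on \<Omega>. \<bar>\<Phi> n x - fun_of \<Omega> U x\<bar>) \<longlonglongrightarrow> 0" if "\<Phi> \<in> U"
    using r that by (simp add: represents_def Lp_norm_def)
qed

lemma C1_0_integrable: "\<phi> \<in> C1_0 \<Omega> \<Longrightarrow> integrable (lebesgue_on \<Omega>) \<phi>"
  by (intro integrable_continuous C1_0_continuous)

text \<open>Limits in \<open>L\<^sup>1\<close> are unique up to null sets.\<close>

lemma fun_of_cls_AE:
  assumes "cauchy \<Phi>" "integrable (lebesgue_on \<Omega>) w"
    and "(\<lambda>n. LINT x|lebesgue_on \<Omega>. \<bar>\<Phi> n x - w x\<bar>) \<longlonglongrightarrow> 0"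
  shows "AE x in lebesgue_on \<Omega>. fun_of \<Omega> (cls \<Phi>) x = w x"
proof -
  let ?u = "fun_of \<Omega> (cls \<Phi>)" and ?M = "lebesgue_on \<Omega>"
  note u = fun_of_represents(1)[OF cls_in_HX[OF assms(1)]]
  note lim = fun_of_represents(2)[OF cls_in_HX[OF assms(1)] mem_cls[OF assms(1)]]
  have \<Phi>: "integrable ?M (\<Phi> n)" for n using assms(1) by (intro C1_0_integrable cauchy_in)
  have "(LINT x|?M. \<bar>?u x - w x\<bar>) \<le> (LINT x|?M. \<bar>\<Phi> n x - ?u x\<bar>) + (LINT x|?M. \<bar>\<Phi> n x - w x\<bar>)" for n
  proof -
    have "(LINT x|?M. \<bar>?u x - w x\<bar>) \<le> (LINT x|?M. \<bar>\<Phi> n x - ?u x\<bar> + \<bar>\<Phi> n x - w x\<bar>)"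
      using u \<Phi> assms(2) by (intro integral_mono) auto
    then show ?thesis using u \<Phi> assms(2) by simp
  qed
  moreover have "(\<lambda>n. (LINT x|?M. \<bar>\<Phi> n x - ?u x\<bar>) + (LINT x|?M. \<bar>\<Phi> n x - w x\<bar>)) \<longlonglongrightarrow> 0"
    using tendsto_add[OF lim assms(3)] by simp
  ultimately have "(LINT x|?M. \<bar>?u x - w x\<bar>) \<le> 0"
    by (intro LIMSEQ_le_const) blast+
  then have "(LINT x|?M. \<bar>?u x - w x\<bar>) = 0"
    by (intro antisym Bochner_Integration.integral_nonneg) auto
  then show ?thesis
    using u assms(2) by (subst (asm) integral_nonneg_eq_0_iff_AE) auto
qed

text \<open>Elements of the completion that agree almost everywhere as functions are equal; a Cauchy sequence
  is therefore identified by its \<open>L\<^sup>1\<close> limit.\<close>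

lemma cls_eq_by_fun:
  assumes "cauchy \<Phi>" "V \<in> HX \<Omega> X"
    and "(\<lambda>n. LINT x|lebesgue_on \<Omega>. \<bar>\<Phi> n x - fun_of \<Omega> V x\<bar>) \<longlonglongrightarrow> 0"
  shows "cls \<Phi> = V"
proof -
  have "AE x in lebesgue_on \<Omega>. fun_of \<Omega> (cls \<Phi>) x = fun_of \<Omega> V x"
    using assms fun_of_represents(1) by (intro fun_of_cls_AE)
  moreover have "\<forall>U\<in>HX \<Omega> X. \<forall>V\<in>HX \<Omega> X.
      (AE x in lebesgue_on \<Omega>. fun_of \<Omega> U x = fun_of \<Omega> V x) \<longrightarrow> U = V"
    using embedding[unfolded assumption_S_def, THEN conjunct2] by (rule conjunct1)
  ultimately show ?thesis
    using assms(2) cls_in_HX[OF assms(1)] by blast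
qed

lemma AE_convergent_subseq:
  assumes "U \<in> HX \<Omega> X" "\<Phi> \<in> U"
  obtains r where "strict_mono r" "\<Phi> \<circ> r \<in> U"
    "AE x in lebesgue_on \<Omega>. (\<lambda>n. \<Phi> (r n) x) \<longlonglongrightarrow> fun_of \<Omega> U x"
proof -
  have "\<exists>r. strict_mono r \<and> (AE x in lebesgue_on \<Omega>. (\<lambda>n. \<Phi> (r n) x - fun_of \<Omega> U x) \<longlonglongrightarrow> 0)"
  proof (rule tendsto_L1_AE_subseq)
    show "integrable (lebesgue_on \<Omega>) (\<lambda>x. \<Phi> n x - fun_of \<Omega> U x)" for n
      using fun_of_represents(1)[OF assms(1)] C1_0_integrable[OF cauchy_in[OF HX_mem(1)[OF assms]]]
      by (rule Bochner_Integration.integrable_diff[rotated])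
    show "(\<lambda>n. LINT x|lebesgue_on \<Omega>. norm (\<Phi> n x - fun_of \<Omega> U x)) \<longlonglongrightarrow> 0"
      using fun_of_represents(2)[OF assms] by simp
  qed
  then obtain r where r: "strict_mono r"
    "AE x in lebesgue_on \<Omega>. (\<lambda>n. \<Phi> (r n) x - fun_of \<Omega> U x) \<longlonglongrightarrow> 0" by blast
  from r(2) have "AE x in lebesgue_on \<Omega>. (\<lambda>n. \<Phi> (r n) x) \<longlonglongrightarrow> fun_of \<Omega> U x"
    by eventually_elim (simp add: LIM_zero_iff)
  then show ?thesis using that r(1) subseq_in_class[OF assms r(1)] by blast
qed

text \<open>Truncating a sequence of \<open>V\<close> at level \<open>M\<close> keeps its \<open>L\<^sup>1\<close> limit and does not increase its energies,
  but strong convergence could be lost. The nested minimization of the energy over the bounded test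
  functions that are \<open>L\<^sup>1\<close>-close to \<open>V\<close> restores it: it yields a Cauchy sequence, and the \<open>L\<^sup>1\<close> limit
  identifies its class as \<open>V\<close>.\<close>

lemma bounded_approximation:
  assumes V: "V \<in> HX \<Omega> X" and M: "0 \<le> M" and bd: "AE x in lebesgue_on \<Omega>. \<bar>fun_of \<Omega> V x\<bar> \<le> M"
  obtains \<Psi> where "\<Psi> \<in> V" "\<And>n x. \<bar>\<Psi> n x\<bar> \<le> M + 1"
    "AE x in lebesgue_on \<Omega>. (\<lambda>n. \<Psi> n x) \<longlonglongrightarrow> fun_of \<Omega> V x"
proof -
  let ?v = "fun_of \<Omega> V" and ?L = "lebesgue_on \<Omega>"
  note v = fun_of_represents(1)[OF V]
  obtain \<Phi> where \<Phi>: "\<Phi> \<in> V" "cauchy \<Phi>" using HX_obtain[OF V] .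
  obtain S where S: "\<And>n. nrm (\<Phi> n) \<le> S" using cauchy_bounded[OF \<Phi>(2)] by blast
  obtain \<theta> \<theta>' where \<theta>: "\<And>s. (\<theta> has_real_derivative \<theta>' s) (at s)" "continuous_on UNIV \<theta>'"
    "\<And>s. 0 \<le> \<theta>' s" "\<And>s. \<theta>' s \<le> 1" "\<And>s. \<bar>s\<bar> \<le> M \<Longrightarrow> \<theta> s = s" "\<And>s. \<bar>\<theta> s\<bar> \<le> M + 1"
    using C1_truncation[OF M zero_less_one] by metis
  have \<theta>0: "\<theta> 0 = 0" using \<theta>(5)[of 0] M by simp
  have lip: "\<bar>\<theta> s - \<theta> t\<bar> \<le> \<bar>s - t\<bar>" for s t
    using field_differentiable_bound[of UNIV \<theta> \<theta>' 1 s t] \<theta>(1,3,4) by simp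
  define K where "K n = {\<phi> \<in> C1_0 \<Omega>. (\<forall>x. \<bar>\<phi> x\<bar> \<le> M + 1) \<and>
      (LINT x|?L. \<bar>\<phi> x - ?v x\<bar>) \<le> 1 / Suc n}" for n
  obtain z where z: "\<And>n. z n \<in> K n" "cauchy z"
  proof (rule nested_minimization[of K 0 "\<lambda>\<phi>. form \<phi> \<phi>" "S\<^sup>2" "1 / 4"])
    show "K n \<subseteq> C1_0 \<Omega>" for n by (auto simp: K_def)
    show "K (Suc n) \<subseteq> K n" for n
    proof -
      have "1 / real (Suc (Suc n)) \<le> 1 / real (Suc n)" by (intro divide_left_mono) auto
      then show ?thesis unfolding K_def by (auto intro: order_trans)
    qed
    show "(\<lambda>x. (\<phi> x + \<psi> x) / 2) \<in> K n" if "\<phi> \<in> K n" "\<psi> \<in> K n" for n \<phi> \<psi>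
    proof -
      have C: "\<phi> \<in> C1_0 \<Omega>" "\<psi> \<in> C1_0 \<Omega>" and b: "\<And>x. \<bar>\<phi> x\<bar> \<le> M + 1" "\<And>x. \<bar>\<psi> x\<bar> \<le> M + 1"
        and i: "(LINT x|?L. \<bar>\<phi> x - ?v x\<bar>) \<le> 1 / Suc n" "(LINT x|?L. \<bar>\<psi> x - ?v x\<bar>) \<le> 1 / Suc n"
        using that by (auto simp: K_def)
      have C': "(\<lambda>x. (\<phi> x + \<psi> x) / 2) \<in> C1_0 \<Omega>"
        using lincomb[OF C, of "1/2" "1/2"] by (simp add: add_divide_distrib)
      have "(LINT x|?L. \<bar>(\<phi> x + \<psi> x) / 2 - ?v x\<bar>) \<le> (LINT x|?L. \<bar>\<phi> x - ?v x\<bar> / 2 + \<bar>\<psi> x - ?v x\<bar> / 2)"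
      proof (rule integral_mono)
        show "\<bar>(\<phi> x + \<psi> x) / 2 - ?v x\<bar> \<le> \<bar>\<phi> x - ?v x\<bar> / 2 + \<bar>\<psi> x - ?v x\<bar> / 2" for x
        proof -
          have "(\<phi> x + \<psi> x) / 2 - ?v x = (\<phi> x - ?v x) / 2 + (\<psi> x - ?v x) / 2"
            by (simp add: field_simps)
          then show ?thesis
            using abs_triangle_ineq[of "(\<phi> x - ?v x) / 2" "(\<psi> x - ?v x) / 2"] by simp
        qed
      qed (use v C1_0_integrable[OF C(1)] C1_0_integrable[OF C(2)] in auto)
      also have "\<dots> = (LINT x|?L. \<bar>\<phi> x - ?v x\<bar>) / 2 + (LINT x|?L. \<bar>\<psi> x - ?v x\<bar>) / 2"
        using v C1_0_integrable[OF C(1)] C1_0_integrable[OF C(2)] by simp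
      finally have "(LINT x|?L. \<bar>(\<phi> x + \<psi> x) / 2 - ?v x\<bar>) \<le> 1 / Suc n" using i by argo
      moreover have "\<bar>(\<phi> x + \<psi> x) / 2\<bar> \<le> M + 1" for x using b(1)[of x] b(2)[of x] by (simp add: abs_le_iff)
      ultimately show ?thesis using C' by (simp add: K_def)
    qed
    show "0 \<le> form \<phi> \<phi>" if "\<phi> \<in> K 0" for \<phi> using that by (simp add: K_def form_nonneg)
    show "\<exists>\<phi>\<in>K n. form \<phi> \<phi> \<le> S\<^sup>2" for n
    proof -
      have "\<forall>\<^sub>F m in sequentially. (LINT x|?L. \<bar>\<Phi> m x - ?v x\<bar>) < 1 / Suc n"
        using fun_of_represents(2)[OF V \<Phi>(1)] by (rule order_tendstoD) simp
      then obtain m where m: "(LINT x|?L. \<bar>\<Phi> m x - ?v x\<bar>) < 1 / Suc n"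
        using eventually_happens'[OF sequentially_bot] by blast
      have C: "\<Phi> m \<in> C1_0 \<Omega>" using \<Phi>(2) by (rule cauchy_in)
      have C': "(\<lambda>x. \<theta> (\<Phi> m x)) \<in> C1_0 \<Omega>" by (rule C1_0_compose(1)[OF C \<theta>(1,2) \<theta>0])
      \<comment> \<open>\<open>\<theta>\<close> fixes the values of \<open>v\<close> and is a contraction, so truncation brings \<open>\<Phi>\<^sub>m\<close> no further from \<open>v\<close>.\<close>
      have "(LINT x|?L. \<bar>\<theta> (\<Phi> m x) - ?v x\<bar>) \<le> (LINT x|?L. \<bar>\<Phi> m x - ?v x\<bar>)"
      proof (rule integral_mono_AE)
        show "AE x in ?L. \<bar>\<theta> (\<Phi> m x) - ?v x\<bar> \<le> \<bar>\<Phi> m x - ?v x\<bar>"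
          using bd by eventually_elim (metis lip \<theta>(5))
      qed (use v C1_0_integrable[OF C] C1_0_integrable[OF C'] in auto)
      then have "(\<lambda>x. \<theta> (\<Phi> m x)) \<in> K n" using C' \<theta>(6) m by (simp add: K_def)
      moreover have "form (\<lambda>x. \<theta> (\<Phi> m x)) (\<lambda>x. \<theta> (\<Phi> m x)) \<le> S\<^sup>2"
      proof -
        have "form (\<Phi> m) (\<Phi> m) \<le> S\<^sup>2"
          using S[of m] nrm_square[OF C] nrm_nonneg[OF C] by (metis power_mono)
        then show ?thesis using form_compose_le[OF C \<theta>(1,2) \<theta>0 \<theta>(3,4)] by linarith
      qed
      ultimately show ?thesis by blast
    qed
    show "form (\<lambda>x. (\<phi> x + \<psi> x) / 2) (\<lambda>x. (\<phi> x + \<psi> x) / 2)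
        \<le> (form \<phi> \<phi> + form \<psi> \<psi>) / 2 - 1 / 4 * form (\<lambda>x. \<phi> x - \<psi> x) (\<lambda>x. \<phi> x - \<psi> x)"
      if "\<phi> \<in> K 0" "\<psi> \<in> K 0" for \<phi> \<psi>
      using that form_midpoint[of \<phi> \<psi>] by (simp add: K_def)
  qed (simp, rule that)
  have L1: "(\<lambda>n. LINT x|?L. \<bar>z n x - ?v x\<bar>) \<longlonglongrightarrow> 0"
  proof (rule Lim_null_comparison)
    show "\<forall>\<^sub>F n in sequentially. norm (LINT x|?L. \<bar>z n x - ?v x\<bar>) \<le> 1 / real (Suc n)"
      using z(1) by (intro always_eventually) (simp add: K_def)
    show "(\<lambda>n. 1 / real (Suc n)) \<longlonglongrightarrow> 0" using lim_1_over_n LIMSEQ_Suc by blast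
  qed
  have "z \<in> V" using cls_eq_by_fun[OF z(2) V L1] mem_cls[OF z(2)] by simp
  then obtain r where "strict_mono r" "z \<circ> r \<in> V" "AE x in ?L. (\<lambda>n. z (r n) x) \<longlonglongrightarrow> ?v x"
    using AE_convergent_subseq[OF V] by blast
  then show ?thesis using that[of "z \<circ> r"] z(1) by (simp add: K_def)
qed

section \<open>Uniqueness\<close>

text \<open>Both equations are tested with the difference \<open>w = u - v\<close>, which is bounded. Subtracting them, the
  energy of \<open>w\<close> equals \<open>- \<integral> a (g(u) - g(v)) (u - v) \<le> 0\<close>.\<close>

lemma weak_solution_unique:
  fixes a f :: "real^'n \<Rightarrow> real" and g :: "real \<Rightarrow> real"
  assumes a: "AE x in lebesgue_on \<Omega>. a x \<ge> 0" and "mono g"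
    and U: "weak_solution \<Omega> X B a g f U" "AE x in lebesgue_on \<Omega>. \<bar>fun_of \<Omega> U x\<bar> \<le> M"
    and V: "weak_solution \<Omega> X B a g f V" "AE x in lebesgue_on \<Omega>. \<bar>fun_of \<Omega> V x\<bar> \<le> M"
  shows "U = V"
proof -
  let ?L = "lebesgue_on \<Omega>" and ?u = "fun_of \<Omega> U" and ?v = "fun_of \<Omega> V"
  have UV: "U \<in> HX \<Omega> X" "V \<in> HX \<Omega> X" using U V by (simp_all add: weak_solution_def)
  obtain \<Phi> where \<Phi>: "\<Phi> \<in> U" "cauchy \<Phi>" using HX_obtain[OF UV(1)] .
  obtain \<Psi> where \<Psi>: "\<Psi> \<in> V" "cauchy \<Psi>" using HX_obtain[OF UV(2)] .
  note u = fun_of_represents(1)[OF UV(1)] and v = fun_of_represents(1)[OF UV(2)]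
  define \<Delta> where "\<Delta> n x = \<Phi> n x - \<Psi> n x" for n x
  have \<Delta>: "cauchy \<Delta>" unfolding \<Delta>_def using cauchy_diff[OF \<Phi>(2) \<Psi>(2)] by simp
  let ?W = "cls \<Delta>"
  let ?w = "fun_of \<Omega> ?W"
  have W: "?W \<in> HX \<Omega> X" using cls_in_HX[OF \<Delta>] .
  note w = fun_of_represents(1)[OF W]
  have C: "\<Phi> n \<in> C1_0 \<Omega>" "\<Psi> n \<in> C1_0 \<Omega>" "\<Delta> n \<in> C1_0 \<Omega>" for n
    using \<Phi>(2) \<Psi>(2) \<Delta> by (auto simp: cauchy_def)
  note int = C(1,2)[THEN C1_0_integrable]
  have w_eq: "AE x in ?L. ?w x = ?u x - ?v x"
  proof (rule fun_of_cls_AE[OF \<Delta>])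
    show "integrable ?L (\<lambda>x. ?u x - ?v x)" using u v by simp
    show "(\<lambda>n. LINT x|?L. \<bar>\<Delta> n x - (?u x - ?v x)\<bar>) \<longlonglongrightarrow> 0"
    proof (rule Lim_null_comparison)
      have "(LINT x|?L. \<bar>\<Delta> n x - (?u x - ?v x)\<bar>)
          \<le> (LINT x|?L. \<bar>\<Phi> n x - ?u x\<bar> + \<bar>\<Psi> n x - ?v x\<bar>)" for n
      proof (rule integral_mono)
        show "\<bar>\<Delta> n x - (?u x - ?v x)\<bar> \<le> \<bar>\<Phi> n x - ?u x\<bar> + \<bar>\<Psi> n x - ?v x\<bar>" for x
          unfolding \<Delta>_def by linarith
      qed (use u v int[of n] in \<open>auto simp: \<Delta>_def\<close>)
      moreover have "(LINT x|?L. \<bar>\<Phi> n x - ?u x\<bar> + \<bar>\<Psi> n x - ?v x\<bar>)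
          = (LINT x|?L. \<bar>\<Phi> n x - ?u x\<bar>) + (LINT x|?L. \<bar>\<Psi> n x - ?v x\<bar>)" for n
        using u v int[of n] by simp
      ultimately have "norm (LINT x|?L. \<bar>\<Delta> n x - (?u x - ?v x)\<bar>)
          \<le> (LINT x|?L. \<bar>\<Phi> n x - ?u x\<bar>) + (LINT x|?L. \<bar>\<Psi> n x - ?v x\<bar>)" for n
        by simp
      then show "\<forall>\<^sub>F n in sequentially. norm (LINT x|?L. \<bar>\<Delta> n x - (?u x - ?v x)\<bar>)
          \<le> (LINT x|?L. \<bar>\<Phi> n x - ?u x\<bar>) + (LINT x|?L. \<bar>\<Psi> n x - ?v x\<bar>)"
        by (intro always_eventually allI)
      show "(\<lambda>n. (LINT x|?L. \<bar>\<Phi> n x - ?u x\<bar>) + (LINT x|?L. \<bar>\<Psi> n x - ?v x\<bar>)) \<longlonglongrightarrow> 0"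
        using tendsto_add[OF fun_of_represents(2)[OF UV(1) \<Phi>(1)] fun_of_represents(2)[OF UV(2) \<Psi>(1)]]
        by simp
    qed
  qed
  have w_bd: "AE x in ?L. \<bar>?w x\<bar> \<le> 2 * M"
    using w_eq U(2) V(2) by eventually_elim linarith
  have "in_Linf \<Omega> ?w" using AE_bounded_Linf(1)[OF borel_measurable_integrable[OF w] w_bd] .
  then have eqU: "L_form \<Omega> B U ?W + (LINT x|?L. a x * g (?u x) * ?w x) = (LINT x|?L. f x * ?w x)"
    and eqV: "L_form \<Omega> B V ?W + (LINT x|?L. a x * g (?v x) * ?w x) = (LINT x|?L. f x * ?w x)"
    using U(1) V(1) W unfolding weak_solution_def by blast+
  have ag: "integrable ?L (\<lambda>x. a x * g (?u x))" "integrable ?L (\<lambda>x. a x * g (?v x))"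
    using U(1) V(1) unfolding weak_solution_def by blast+
  have agw: "integrable ?L (\<lambda>x. a x * g (?u x) * ?w x)" "integrable ?L (\<lambda>x. a x * g (?v x) * ?w x)"
    using ag w w_bd by (auto intro: integrable_mult_bounded)
  have "(\<lambda>n. form (\<Phi> n) (\<Delta> n) - form (\<Psi> n) (\<Delta> n)) \<longlonglongrightarrow> L_form \<Omega> B U ?W - L_form \<Omega> B V ?W"
    using L_form_limit[OF UV(1) W \<Phi>(1) mem_cls[OF \<Delta>]] L_form_limit[OF UV(2) W \<Psi>(1) mem_cls[OF \<Delta>]]
    by (rule tendsto_diff)
  moreover have "form (\<Phi> n) (\<Delta> n) - form (\<Psi> n) (\<Delta> n) = (nrm (\<lambda>x. \<Phi> n x - \<Psi> n x))\<^sup>2" for n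
    using form_diff_left[OF C(1,2,3), of n n n] nrm_square[OF C(3), of n] by (simp add: \<Delta>_def[abs_def])
  ultimately have lim: "(\<lambda>n. (nrm (\<lambda>x. \<Phi> n x - \<Psi> n x))\<^sup>2) \<longlonglongrightarrow> L_form \<Omega> B U ?W - L_form \<Omega> B V ?W"
    by simp
  have "0 \<le> (LINT x|?L. a x * g (?u x) * ?w x - a x * g (?v x) * ?w x)"
  proof (rule integral_nonneg_AE)
    show "AE x in ?L. 0 \<le> a x * g (?u x) * ?w x - a x * g (?v x) * ?w x"
      using a w_eq
    proof eventually_elim
      case (elim x)
      have "0 \<le> (g (?u x) - g (?v x)) * (?u x - ?v x)"
        using monoD[OF \<open>mono g\<close>, of "?u x" "?v x"] monoD[OF \<open>mono g\<close>, of "?v x" "?u x"]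
        by (cases "?u x \<le> ?v x") (auto simp: zero_le_mult_iff)
      then have "0 \<le> a x * ((g (?u x) - g (?v x)) * ?w x)" using elim by simp
      then show ?case by (simp add: algebra_simps)
    qed
  qed
  then have "L_form \<Omega> B U ?W - L_form \<Omega> B V ?W \<le> 0"
    using eqU eqV agw by simp
  moreover have "0 \<le> L_form \<Omega> B U ?W - L_form \<Omega> B V ?W"
    using lim by (rule LIMSEQ_le_const) simp
  ultimately have "(\<lambda>n. (nrm (\<lambda>x. \<Phi> n x - \<Psi> n x))\<^sup>2) \<longlonglongrightarrow> 0" using lim by simp
  then have "(\<lambda>n. nrm (\<lambda>x. \<Phi> n x - \<Psi> n x)) \<longlonglongrightarrow> 0" by simp
  then have "cls \<Phi> = cls \<Psi>" using \<Phi>(2) \<Psi>(2) by (intro cls_eqI)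
  then show ?thesis using HX_mem(2)[OF UV(1) \<Phi>(1)] HX_mem(2)[OF UV(2) \<Psi>(1)] by simp
qed

section \<open>Existence\<close>

definition energy ::
    "(real^'n \<Rightarrow> real) \<Rightarrow> (real^'n \<Rightarrow> real) \<Rightarrow> (real \<Rightarrow> real) \<Rightarrow> (real^'n \<Rightarrow> real) \<Rightarrow> real" where
  "energy a f G \<phi> = form \<phi> \<phi> / 2 + (LINT x|lebesgue_on \<Omega>. a x * G (\<phi> x) - f x * \<phi> x)"

text \<open>Test functions are bounded, so the energy is finite on them although \<open>a\<close> and \<open>f\<close> are only in \<open>L\<^sup>1\<close>.\<close>

lemma energy_integrable:
  fixes a f :: "real^'n \<Rightarrow> real"
  assumes a: "integrable (lebesgue_on \<Omega>) a" and f: "integrable (lebesgue_on \<Omega>) f"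
    and G: "continuous_on UNIV G" and \<phi>: "\<phi> \<in> C1_0 \<Omega>"
  shows "integrable (lebesgue_on \<Omega>) (\<lambda>x. a x * G (\<phi> x) - f x * \<phi> x)"
proof -
  have mult: "integrable (lebesgue_on \<Omega>) (\<lambda>x. b x * p x)"
    if b: "integrable (lebesgue_on \<Omega>) b" and p: "continuous_on UNIV p" for b p :: "real^'n \<Rightarrow> real"
  proof -
    have "compact (p ` closure \<Omega>)"
      using bounded_dom by (intro compact_continuous_image continuous_on_subset[OF p]) auto
    then obtain R where R: "\<forall>y\<in>p ` closure \<Omega>. norm y \<le> R"
      using compact_imp_bounded bounded_iff by blast
    have "AE x in lebesgue_on \<Omega>. \<bar>p x\<bar> \<le> R"
      using R closure_subset[of \<Omega>] by (intro AE_I2) auto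
    then show ?thesis by (rule integrable_mult_bounded[OF b measurable_continuous[OF p]])
  qed
  note c = C1_0_continuous[OF \<phi>]
  have "continuous_on UNIV (\<lambda>x. G (\<phi> x))" using c by (intro continuous_on_compose2[OF G]) auto
  then show ?thesis using mult[OF a] mult[OF f c] by (intro Bochner_Integration.integrable_diff)
qed

text \<open>Where \<open>\<bar>s\<bar> \<ge> k\<close>, the slope of \<open>G\<close> is at least \<open>Q\<close> in modulus, so the drop of \<open>a G\<close> under truncation
  outweighs the change of \<open>f s\<close>, which is at most \<open>Q a\<close> times the displacement. Hence the infimum over
  all test functions is also the infimum over those bounded by \<open>k + 1/(n+1)\<close>, and the nested
  minimization applies to these sets.\<close>

lemma minimizing_sequence:
  fixes a f :: "real^'n \<Rightarrow> real" and g G :: "real \<Rightarrow> real" and k Q :: real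
  assumes a: "integrable (lebesgue_on \<Omega>) a" "AE x in lebesgue_on \<Omega>. a x \<ge> 0"
    and f: "integrable (lebesgue_on \<Omega>) f" "AE x in lebesgue_on \<Omega>. \<bar>f x\<bar> \<le> Q * a x"
    and G: "continuous_on UNIV G" "G 0 = 0" "\<And>x y. g x * (y - x) \<le> G y - G x"
    and g: "mono g" "g 0 = 0" "g k = Q" "g (- k) = - Q" and k: "0 \<le> k"
  obtains w d where "cauchy w" "\<And>n x. \<bar>w n x\<bar> \<le> k + 1 / Suc n" "(\<lambda>n. energy a f G (w n)) \<longlonglongrightarrow> d"
    "\<forall>\<phi>\<in>C1_0 \<Omega>. d \<le> energy a f G \<phi>"
proof -
  let ?L = "lebesgue_on \<Omega>" and ?J = "energy a f G"
  define h where "h \<phi> x = a x * G (\<phi> x) - f x * \<phi> x" for \<phi> :: "real^'n \<Rightarrow> real" and x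
  have J_eq: "?J \<phi> = form \<phi> \<phi> / 2 + (LINT x|?L. h \<phi> x)" for \<phi> by (simp add: energy_def h_def)
  have int: "integrable ?L (h \<phi>)" if "\<phi> \<in> C1_0 \<Omega>" for \<phi>
    using energy_integrable[OF a(1) f(1) G(1) that] by (simp add: h_def[abs_def])
  have Q: "0 \<le> Q" using monoD[OF g(1) k] g by simp
  have G_nonneg: "0 \<le> G s" for s using G(3)[of 0 s] G(2) g(2) by simp
  have G_low: "Q * (\<bar>s\<bar> - k) \<le> G s" for s
    using G(3)[of k s] G(3)[of "- k" s] G_nonneg[of k] G_nonneg[of "- k"] g(3,4)
    by (cases "0 \<le> s") (auto simp: algebra_simps)
  define K where "K n = {\<phi> \<in> C1_0 \<Omega>. \<forall>x. \<bar>\<phi> x\<bar> \<le> k + 1 / Suc n}" for n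
  have trunc: "\<exists>\<phi>'\<in>K n. ?J \<phi>' \<le> ?J \<phi>" if \<phi>: "\<phi> \<in> C1_0 \<Omega>" for n \<phi>
  proof -
    obtain \<theta> \<theta>' where \<theta>: "\<And>s. (\<theta> has_real_derivative \<theta>' s) (at s)" "continuous_on UNIV \<theta>'"
      "\<And>s. 0 \<le> \<theta>' s" "\<And>s. \<theta>' s \<le> 1" "\<And>s. \<bar>s\<bar> \<le> k \<Longrightarrow> \<theta> s = s" "\<And>s. \<bar>\<theta> s\<bar> \<le> k + 1 / Suc n"
      "\<And>s. k \<le> s \<Longrightarrow> k \<le> \<theta> s \<and> \<theta> s \<le> s" "\<And>s. s \<le> - k \<Longrightarrow> s \<le> \<theta> s \<and> \<theta> s \<le> - k"
      by (rule C1_truncation[OF k, of "1 / Suc n"]) (simp, rule that)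
    have \<theta>0: "\<theta> 0 = 0" using \<theta>(5)[of 0] k by simp
    let ?\<phi> = "\<lambda>x. \<theta> (\<phi> x)"
    have C: "?\<phi> \<in> C1_0 \<Omega>" by (rule C1_0_compose(1)[OF \<phi> \<theta>(1,2) \<theta>0])
    have drop: "Q * \<bar>s - \<theta> s\<bar> \<le> G s - G (\<theta> s)" for s
    proof -
      consider "\<bar>s\<bar> \<le> k" | "k \<le> s" | "s \<le> - k" by linarith
      then show ?thesis
      proof cases
        case 1 then show ?thesis using \<theta>(5)[of s] by simp
      next
        case 2
        have "Q \<le> g (\<theta> s)" using \<theta>(7)[OF 2] g(1,3) by (metis monoD)
        then have "Q * (s - \<theta> s) \<le> g (\<theta> s) * (s - \<theta> s)" using \<theta>(7)[OF 2] by (intro mult_right_mono) auto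
        then show ?thesis using G(3)[of "\<theta> s" s] \<theta>(7)[OF 2] by simp
      next
        case 3
        have "g (\<theta> s) \<le> - Q" using \<theta>(8)[OF 3] g(1,4) by (metis monoD)
        then have "Q * (\<theta> s - s) \<le> - g (\<theta> s) * (\<theta> s - s)" using \<theta>(8)[OF 3] by (intro mult_right_mono) auto
        then show ?thesis using G(3)[of "\<theta> s" s] \<theta>(8)[OF 3] by (simp add: algebra_simps)
      qed
    qed
    have "(LINT x|?L. h ?\<phi> x) \<le> (LINT x|?L. h \<phi> x)"
    proof (rule integral_mono_AE[OF int[OF C] int[OF \<phi>]])
      show "AE x in ?L. h ?\<phi> x \<le> h \<phi> x"
        using a(2) f(2)
      proof eventually_elim
        case (elim x)
        have "f x * (\<phi> x - \<theta> (\<phi> x)) \<le> \<bar>f x\<bar> * \<bar>\<phi> x - \<theta> (\<phi> x)\<bar>"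
          by (metis abs_ge_self abs_mult)
        also have "\<dots> \<le> Q * a x * \<bar>\<phi> x - \<theta> (\<phi> x)\<bar>" using elim by (intro mult_right_mono) auto
        also have "\<dots> = a x * (Q * \<bar>\<phi> x - \<theta> (\<phi> x)\<bar>)" by simp
        also have "\<dots> \<le> a x * (G (\<phi> x) - G (\<theta> (\<phi> x)))" using elim drop by (intro mult_left_mono) auto
        finally show ?case by (simp add: h_def algebra_simps)
      qed
    qed
    moreover have "form ?\<phi> ?\<phi> \<le> form \<phi> \<phi>" by (rule form_compose_le[OF \<phi> \<theta>(1,2) \<theta>0 \<theta>(3,4)])
    ultimately have "?J ?\<phi> \<le> ?J \<phi>" unfolding J_eq by simp
    moreover have "?\<phi> \<in> K n" using C \<theta>(6) by (simp add: K_def)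
    ultimately show ?thesis by blast
  qed
  have K_C: "\<phi> \<in> C1_0 \<Omega>" if "\<phi> \<in> K n" for \<phi> n using that by (simp add: K_def)
  have mid_C: "(\<lambda>x. (\<phi> x + \<psi> x) / 2) \<in> C1_0 \<Omega>" if "\<phi> \<in> C1_0 \<Omega>" "\<psi> \<in> C1_0 \<Omega>" for \<phi> \<psi>
    using lincomb[OF that, of "1/2" "1/2"] by (simp add: add_divide_distrib)
  have G_mid: "G ((s + t) / 2) \<le> (G s + G t) / 2" for s t
  proof -
    have "s - (s + t) / 2 = (s - t) / 2" "t - (s + t) / 2 = - ((s - t) / 2)" by argo+
    then have "g ((s + t) / 2) * (s - (s + t) / 2) = - (g ((s + t) / 2) * (t - (s + t) / 2))"
      by (simp only: mult_minus_right minus_minus)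
    then show ?thesis using G(3)[of "(s + t) / 2" s] G(3)[of "(s + t) / 2" t] by argo
  qed
  have K_sub: "K n \<subseteq> C1_0 \<Omega>" for n using K_C by blast
  have K_mono: "K (Suc n) \<subseteq> K n" for n
  proof -
    have "1 / real (Suc (Suc n)) \<le> 1 / real (Suc n)" by (intro divide_left_mono) auto
    then have "k + 1 / real (Suc (Suc n)) \<le> k + 1 / real (Suc n)" by simp
    then show ?thesis unfolding K_def by (blast intro: order_trans)
  qed
  have K_mid: "(\<lambda>x. (\<phi> x + \<psi> x) / 2) \<in> K n" if "\<phi> \<in> K n" "\<psi> \<in> K n" for n \<phi> \<psi>
  proof -
    have "\<bar>(\<phi> x + \<psi> x) / 2\<bar> \<le> k + 1 / Suc n" for x
    proof -
      have "\<bar>\<phi> x\<bar> \<le> k + 1 / Suc n" "\<bar>\<psi> x\<bar> \<le> k + 1 / Suc n" using that by (auto simp: K_def)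
      then show ?thesis by (simp add: abs_le_iff)
    qed
    then show ?thesis using mid_C[OF K_C[OF that(1)] K_C[OF that(2)]] by (simp add: K_def)
  qed
  \<comment> \<open>The linear term is absorbed, since \<open>G(s) \<ge> Q (\<bar>s\<bar> - k)\<close> and \<open>\<bar>f\<bar> \<le> Q a\<close>.\<close>
  have low: "- (LINT x|?L. Q * k * a x) \<le> ?J \<phi>" if "\<phi> \<in> K 0" for \<phi>
  proof -
    note \<phi> = K_C[OF that]
    have "(LINT x|?L. - (Q * k * a x)) \<le> (LINT x|?L. h \<phi> x)"
    proof (rule integral_mono_AE)
      show "AE x in ?L. - (Q * k * a x) \<le> h \<phi> x"
        using a(2) f(2)
      proof eventually_elim
        case (elim x)
        have "f x * \<phi> x \<le> \<bar>f x\<bar> * \<bar>\<phi> x\<bar>" by (metis abs_ge_self abs_mult)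
        also have "\<dots> \<le> Q * a x * \<bar>\<phi> x\<bar>" using elim by (intro mult_right_mono) auto
        finally have "f x * \<phi> x \<le> Q * a x * \<bar>\<phi> x\<bar>" .
        moreover have "a x * (Q * (\<bar>\<phi> x\<bar> - k)) \<le> a x * G (\<phi> x)"
          using elim G_low by (intro mult_left_mono) auto
        ultimately show ?case by (simp add: h_def algebra_simps)
      qed
    qed (use a(1) int[OF \<phi>] in simp_all)
    then show ?thesis using form_nonneg[OF \<phi>] by (simp add: J_eq)
  qed
  \<comment> \<open>The quadratic part of \<open>J\<close> carries the factor \<open>1/2\<close>, so the parallelogram identity contributes \<open>1/8\<close>.\<close>
  have mid: "?J (\<lambda>x. (\<phi> x + \<psi> x) / 2) \<le> (?J \<phi> + ?J \<psi>) / 2 - 1 / 8 * form (\<lambda>x. \<phi> x - \<psi> x) (\<lambda>x. \<phi> x - \<psi> x)"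
    if "\<phi> \<in> K 0" "\<psi> \<in> K 0" for \<phi> \<psi>
  proof -
    note C = K_C[OF that(1)] K_C[OF that(2)]
    let ?m = "\<lambda>x. (\<phi> x + \<psi> x) / 2"
    have "form ?m ?m / 2 = (form \<phi> \<phi> / 2 + form \<psi> \<psi> / 2) / 2 - 1 / 8 * form (\<lambda>x. \<phi> x - \<psi> x) (\<lambda>x. \<phi> x - \<psi> x)"
      using form_midpoint[OF C] by argo
    moreover have "(LINT x|?L. h ?m x) \<le> (LINT x|?L. h \<phi> x / 2 + h \<psi> x / 2)"
    proof (rule integral_mono_AE)
      show "AE x in ?L. h ?m x \<le> h \<phi> x / 2 + h \<psi> x / 2"
        using a(2)
      proof eventually_elim
        case (elim x)
        then have "a x * G ((\<phi> x + \<psi> x) / 2) \<le> a x * ((G (\<phi> x) + G (\<psi> x)) / 2)"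
          using G_mid by (intro mult_left_mono)
        then show ?case by (simp add: h_def field_simps)
      qed
    qed (use int[OF C(1)] int[OF C(2)] int[OF mid_C[OF C]] in simp_all)
    moreover have "(LINT x|?L. h \<phi> x / 2 + h \<psi> x / 2) = (LINT x|?L. h \<phi> x) / 2 + (LINT x|?L. h \<psi> x) / 2"
      using int[OF C(1)] int[OF C(2)] by simp
    ultimately show ?thesis unfolding J_eq by argo
  qed
  obtain z d where z: "\<And>n. z n \<in> K n" "cauchy z" "(\<lambda>n. ?J (z n)) \<longlonglongrightarrow> d"
    "\<forall>v. (\<forall>n. \<exists>\<phi>\<in>K n. ?J \<phi> \<le> v) \<longrightarrow> d \<le> v"
  proof (rule nested_minimization[of K "- (LINT x|?L. Q * k * a x)" ?J "?J (\<lambda>x. 0)" "1 / 8"])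
    show "\<exists>\<phi>\<in>K n. ?J \<phi> \<le> ?J (\<lambda>x. 0)" for n using trunc[OF C1_0_zero] .
    show "(0::real) < 1 / 8" by simp
  qed (rule K_sub, rule K_mono, rule K_mid, assumption+, rule low, assumption, rule mid, assumption+, rule that)
  show ?thesis
  proof (rule that[OF z(2) _ z(3)])
    show "\<bar>z n x\<bar> \<le> k + 1 / Suc n" for n x using z(1)[of n] by (simp add: K_def)
    show "\<forall>\<phi>\<in>C1_0 \<Omega>. d \<le> ?J \<phi>" using z(4) trunc by blast
  qed
qed

text \<open>The limit of the minimizing sequence solves the equation. The first variation is taken along the
  minimizing sequence and not at the limit itself, so that all comparison functions are test
  functions, on which the energy is finite.\<close>

lemma weak_solution_exists:
  fixes a f :: "real^'n \<Rightarrow> real" and g :: "real \<Rightarrow> real" and k Q :: real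
  assumes a: "integrable (lebesgue_on \<Omega>) a" "AE x in lebesgue_on \<Omega>. a x \<ge> 0"
    and f: "integrable (lebesgue_on \<Omega>) f" "AE x in lebesgue_on \<Omega>. \<bar>f x\<bar> \<le> Q * a x"
    and g: "continuous_on UNIV g" "mono g" "g 0 = 0" "g k = Q" "g (- k) = - Q" and k: "0 \<le> k"
  obtains U where "weak_solution \<Omega> X B a g f U" "AE x in lebesgue_on \<Omega>. \<bar>fun_of \<Omega> U x\<bar> \<le> k"
proof -
  let ?L = "lebesgue_on \<Omega>"
  obtain G where G: "continuous_on UNIV G" "G 0 = 0" "\<And>x y. g x * (y - x) \<le> G y - G x"
    by (rule monotone_antiderivative[OF g(1,2)]) (rule that)
  define h where "h \<phi> x = a x * G (\<phi> x) - f x * \<phi> x" for \<phi> :: "real^'n \<Rightarrow> real" and x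
  let ?J = "energy a f G"
  have J_eq: "?J \<phi> = form \<phi> \<phi> / 2 + (LINT x|?L. h \<phi> x)" for \<phi> by (simp add: energy_def h_def)
  have h_int: "integrable ?L (h \<phi>)" if "\<phi> \<in> C1_0 \<Omega>" for \<phi>
    using energy_integrable[OF a(1) f(1) G(1) that] by (simp add: h_def[abs_def])
  obtain z d where z: "cauchy z" "\<And>n x. \<bar>z n x\<bar> \<le> k + 1 / Suc n" "(\<lambda>n. ?J (z n)) \<longlonglongrightarrow> d"
    and J_min: "\<forall>\<phi>\<in>C1_0 \<Omega>. d \<le> ?J \<phi>"
    by (rule minimizing_sequence[OF a f G g(2-5) k]) (rule that)
  note J_ge = bspec[OF J_min]
  define U where "U = cls z"
  let ?u = "fun_of \<Omega> U"
  have U: "U \<in> HX \<Omega> X" "z \<in> U" unfolding U_def using cls_in_HX[OF z(1)] mem_cls[OF z(1)] .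
  have u_m: "?u \<in> borel_measurable ?L" using fun_of_represents(1)[OF U(1)] by (rule borel_measurable_integrable)
  obtain r where r: "strict_mono r" "z \<circ> r \<in> U" "AE x in ?L. (\<lambda>n. z (r n) x) \<longlonglongrightarrow> ?u x"
    by (rule AE_convergent_subseq[OF U]) (rule that)
  define w where "w = z \<circ> r"
  have w: "w \<in> U" "cauchy w" using r(2) HX_mem(1)[OF U(1)] by (simp_all add: w_def)
  have w_lim: "AE x in ?L. (\<lambda>n. w n x) \<longlonglongrightarrow> ?u x" using r(3) by (simp add: w_def)
  have w_bd: "\<bar>w n x\<bar> \<le> k + 1 / Suc n" for n x
  proof -
    have "1 / real (Suc (r n)) \<le> 1 / real (Suc n)"
      using strict_mono_imp_increasing[OF r(1), of n] by (intro divide_left_mono) auto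
    then show ?thesis using z(2)[of "r n" x] by (simp add: w_def)
  qed
  have wC: "w n \<in> C1_0 \<Omega>" for n using w(2) by (rule cauchy_in)
  have Jw: "(\<lambda>n. ?J (w n)) \<longlonglongrightarrow> d"
    using LIMSEQ_subseq_LIMSEQ[OF z(3) r(1)] by (simp add: w_def comp_def)
  have lim0: "(\<lambda>n. 1 / real (Suc n)) \<longlonglongrightarrow> 0" using lim_1_over_n LIMSEQ_Suc by blast
  have u_bd: "AE x in ?L. \<bar>?u x\<bar> \<le> k"
    using w_lim
  proof eventually_elim
    case (elim x)
    have "(\<lambda>n. k + 1 / real (Suc n)) \<longlonglongrightarrow> k" using tendsto_add[OF tendsto_const lim0, of k] by simp
    then show ?case using LIMSEQ_le[OF tendsto_rabs[OF elim]] w_bd by blast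
  qed
  have g_m: "(\<lambda>x. g (p x)) \<in> borel_measurable ?L" if "p \<in> borel_measurable ?L" for p
    using that borel_measurable_continuous_onI[OF g(1)] by (rule measurable_compose)
  have g_bd: "\<bar>g s\<bar> \<le> \<bar>g R\<bar> + \<bar>g (- R)\<bar>" if "\<bar>s\<bar> \<le> R" for s R
  proof -
    have "g s \<le> g R" "g (- R) \<le> g s" using that by (auto intro!: monoD[OF g(2)])
    then show ?thesis by linarith
  qed
  have ag: "integrable ?L (\<lambda>x. a x * g (?u x))"
  proof (rule integrable_mult_bounded[OF a(1) g_m[OF u_m]])
    show "AE x in ?L. \<bar>g (?u x)\<bar> \<le> \<bar>g k\<bar> + \<bar>g (- k)\<bar>"
      using u_bd by eventually_elim (rule g_bd)
  qed
  have EL: "L_form \<Omega> B U V + (LINT x|?L. a x * g (?u x) * fun_of \<Omega> V x) = (LINT x|?L. f x * fun_of \<Omega> V x)"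
    if V: "V \<in> HX \<Omega> X" and Vb: "in_Linf \<Omega> (fun_of \<Omega> V)" for V
  proof -
    let ?v = "fun_of \<Omega> V"
    have v_m: "?v \<in> borel_measurable ?L" using fun_of_represents(1)[OF V] by (rule borel_measurable_integrable)
    obtain M where M: "0 \<le> M" "AE x in ?L. \<bar>?v x\<bar> \<le> M"
      by (rule in_Linf_AE_bounded[OF Vb]) (rule that)
    obtain \<Psi> where \<Psi>: "\<Psi> \<in> V" "\<And>n x. \<bar>\<Psi> n x\<bar> \<le> M + 1" "AE x in ?L. (\<lambda>n. \<Psi> n x) \<longlonglongrightarrow> ?v x"
      by (rule bounded_approximation[OF V M]) (rule that)
    have \<Psi>C: "\<Psi> n \<in> C1_0 \<Omega>" for n using HX_mem(1)[OF V \<Psi>(1)] by (rule cauchy_in)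
    have gap: "0 \<le> ?J (w n) - d" for n using J_ge[OF wC] by simp
    \<comment> \<open>The step exceeds the square root of the energy gap, so that the gap divided by \<open>t\<^sub>n\<close> still tends to zero; the summand \<open>1/(n+1)\<close> keeps \<open>t\<^sub>n\<close> positive.\<close>
    define t where "t n = sqrt (?J (w n) - d) + 1 / Suc n" for n
    have t_pos: "0 < t n" for n using gap[of n] by (simp add: t_def add_nonneg_pos)
    have t_lim: "t \<longlonglongrightarrow> 0"
    proof -
      have "(\<lambda>n. ?J (w n) - d) \<longlonglongrightarrow> 0" using Jw by (simp add: LIM_zero)
      then have "(\<lambda>n. sqrt (?J (w n) - d)) \<longlonglongrightarrow> 0" using tendsto_real_sqrt by fastforce
      then show ?thesis unfolding t_def using tendsto_add[OF _ lim0] by fastforce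
    qed
    have t_gap: "?J (w n) - d \<le> (t n)\<^sup>2" for n
    proof -
      have "(sqrt (?J (w n) - d))\<^sup>2 \<le> (t n)\<^sup>2" using gap[of n] by (intro power_mono) (simp_all add: t_def)
      then show ?thesis using gap[of n] by simp
    qed
    obtain T where T: "\<And>n. \<bar>t n\<bar> \<le> T"
      using convergent_imp_Bseq[OF convergentI[OF t_lim]] by (auto simp: Bseq_def)
    define R where "R = k + 1 + T * (M + 1)"
    define S where "S = \<bar>g R\<bar> + \<bar>g (- R)\<bar>"
    \<comment> \<open>Both signs of the variation are needed; they give the two inequalities that make up the equation.\<close>
    have signed: "0 \<le> \<sigma> * (L_form \<Omega> B U V + (LINT x|?L. (a x * g (?u x) - f x) * ?v x))"
      if \<sigma>: "\<sigma>\<^sup>2 = 1" "\<bar>\<sigma>\<bar> = 1" for \<sigma> :: real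
    proof -
      define y where "y n x = w n x + \<sigma> * t n * \<Psi> n x" for n x
      have yC: "y n \<in> C1_0 \<Omega>" for n
        using lincomb[OF wC \<Psi>C, of 1 n "\<sigma> * t n" n] by (simp add: y_def[abs_def])
      have y_bd: "\<bar>y n x\<bar> \<le> R" for n x
      proof -
        have "\<bar>\<sigma> * t n * \<Psi> n x\<bar> \<le> T * (M + 1)"
          using \<sigma>(2) T[of n] \<Psi>(2)[of n x] M(1) by (auto simp: abs_mult intro!: mult_mono)
        moreover have "1 / real (Suc n) \<le> 1" by simp
        ultimately show ?thesis unfolding y_def R_def using w_bd[of n x] by linarith
      qed
      have y_m: "y n \<in> borel_measurable ?L" and \<Psi>_m: "\<Psi> n \<in> borel_measurable ?L" for n
        using yC \<Psi>C by (auto intro: measurable_continuous C1_0_continuous)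
      have \<Psi>_bd: "AE x in ?L. \<bar>\<Psi> n x\<bar> \<le> M + 1" for n using \<Psi>(2) by simp
      have agy: "integrable ?L (\<lambda>x. a x * g (y n x))" for n
        by (rule integrable_mult_bounded[OF a(1) g_m[OF y_m], where R = S])
          (use g_bd[OF y_bd] in \<open>simp add: S_def\<close>)
      define q where "q n x = (a x * g (y n x) - f x) * \<Psi> n x" for n x
      have q_int: "integrable ?L (q n)" for n
        unfolding q_def
        by (rule integrable_mult_bounded[OF Bochner_Integration.integrable_diff[OF agy f(1)] \<Psi>_m \<Psi>_bd])
      have ineq: "0 \<le> \<sigma> * form (w n) (\<Psi> n) + t n / 2 * form (\<Psi> n) (\<Psi> n) + \<sigma> * (LINT x|?L. q n x) + t n" for n
      proof -
        have "(LINT x|?L. h (y n) x - h (w n) x) \<le> (LINT x|?L. \<sigma> * t n * q n x)"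
        proof (rule integral_mono_AE)
          show "AE x in ?L. h (y n) x - h (w n) x \<le> \<sigma> * t n * q n x"
            using a(2)
          proof eventually_elim
            case (elim x)
            \<comment> \<open>Convexity replaces the difference quotient of \<open>G\<close> by the slope at the displaced point.\<close>
            have "G (y n x) - G (w n x) \<le> g (y n x) * (\<sigma> * t n * \<Psi> n x)"
              using G(3)[of "y n x" "w n x"] by (simp add: y_def)
            then have "a x * (G (y n x) - G (w n x)) \<le> a x * (g (y n x) * (\<sigma> * t n * \<Psi> n x))"
              using elim by (rule mult_left_mono)
            moreover have "y n x - w n x = \<sigma> * t n * \<Psi> n x" by (simp add: y_def)
            ultimately show ?case by (simp add: h_def q_def algebra_simps)
          qed
        qed (use h_int[OF yC] h_int[OF wC] q_int in simp_all)
        then have "(LINT x|?L. h (y n) x) - (LINT x|?L. h (w n) x) \<le> \<sigma> * t n * (LINT x|?L. q n x)"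
          using h_int[OF yC] h_int[OF wC] by simp
        moreover have "form (y n) (y n)
            = form (w n) (w n) + 2 * (\<sigma> * t n) * form (w n) (\<Psi> n) + (t n)\<^sup>2 * form (\<Psi> n) (\<Psi> n)"
          using form_expand[OF wC \<Psi>C, of 1 n "\<sigma> * t n" n] \<sigma>(1)
          by (simp add: y_def[abs_def] power_mult_distrib)
        moreover have "d \<le> ?J (y n)" using J_ge[OF yC] .
        ultimately have "0 \<le> \<sigma> * t n * form (w n) (\<Psi> n) + (t n)\<^sup>2 / 2 * form (\<Psi> n) (\<Psi> n)
            + \<sigma> * t n * (LINT x|?L. q n x) + (t n)\<^sup>2"
          using t_gap[of n] unfolding J_eq by argo
        also have "\<dots> = t n * (\<sigma> * form (w n) (\<Psi> n) + t n / 2 * form (\<Psi> n) (\<Psi> n)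
            + \<sigma> * (LINT x|?L. q n x) + t n)"
          by (simp add: algebra_simps power2_eq_square)
        finally show ?thesis using t_pos[of n] by (simp add: zero_le_mult_iff)
      qed
      have q_lim: "(\<lambda>n. LINT x|?L. q n x) \<longlonglongrightarrow> (LINT x|?L. (a x * g (?u x) - f x) * ?v x)"
      proof (rule integral_dominated_convergence[where w = "\<lambda>x. (\<bar>a x\<bar> * S + \<bar>f x\<bar>) * (M + 1)"])
        show "(\<lambda>x. (a x * g (?u x) - f x) * ?v x) \<in> borel_measurable ?L"
          using ag f(1)
          by (intro borel_measurable_times[OF borel_measurable_diff v_m] borel_measurable_integrable)
        show "q n \<in> borel_measurable ?L" for n using q_int by (rule borel_measurable_integrable)
        show "integrable ?L (\<lambda>x. (\<bar>a x\<bar> * S + \<bar>f x\<bar>) * (M + 1))" using a(1) f(1) by simp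
        show "AE x in ?L. norm (q n x) \<le> (\<bar>a x\<bar> * S + \<bar>f x\<bar>) * (M + 1)" for n
        proof (rule AE_I2)
          fix x
          have "\<bar>a x * g (y n x) - f x\<bar> \<le> \<bar>a x\<bar> * \<bar>g (y n x)\<bar> + \<bar>f x\<bar>"
            using abs_triangle_ineq4[of "a x * g (y n x)" "f x"] by (simp add: abs_mult)
          also have "\<dots> \<le> \<bar>a x\<bar> * S + \<bar>f x\<bar>"
            using g_bd[OF y_bd[of n x]] by (simp add: S_def mult_left_mono)
          finally show "norm (q n x) \<le> (\<bar>a x\<bar> * S + \<bar>f x\<bar>) * (M + 1)"
            using \<Psi>(2)[of n x] by (auto simp: q_def abs_mult intro!: mult_mono)
        qed
        show "AE x in ?L. (\<lambda>n. q n x) \<longlonglongrightarrow> (a x * g (?u x) - f x) * ?v x"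
          using w_lim \<Psi>(3)
        proof eventually_elim
          case (elim x)
          have "(\<lambda>n. y n x) \<longlonglongrightarrow> ?u x + \<sigma> * 0 * ?v x"
            unfolding y_def by (intro tendsto_intros elim t_lim)
          then have "(\<lambda>n. g (y n x)) \<longlonglongrightarrow> g (?u x)"
            using continuous_on_tendsto_compose[OF g(1)] by simp
          then show ?case unfolding q_def by (intro tendsto_intros elim)
        qed
      qed
      have "(\<lambda>n. \<sigma> * form (w n) (\<Psi> n) + t n / 2 * form (\<Psi> n) (\<Psi> n) + \<sigma> * (LINT x|?L. q n x) + t n)
          \<longlonglongrightarrow> \<sigma> * L_form \<Omega> B U V + 0 / 2 * L_form \<Omega> B V V
            + \<sigma> * (LINT x|?L. (a x * g (?u x) - f x) * ?v x) + 0"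
        by (intro tendsto_intros q_lim t_lim L_form_limit[OF U(1) V w(1) \<Psi>(1)] L_form_limit[OF V V \<Psi>(1) \<Psi>(1)]) simp
      then have "0 \<le> \<sigma> * L_form \<Omega> B U V + 0 / 2 * L_form \<Omega> B V V
            + \<sigma> * (LINT x|?L. (a x * g (?u x) - f x) * ?v x) + 0"
        by (rule LIMSEQ_le_const) (use ineq in blast)
      then show ?thesis by (simp add: distrib_left)
    qed
    have "L_form \<Omega> B U V + (LINT x|?L. (a x * g (?u x) - f x) * ?v x) = 0"
      using signed[of 1] signed[of "-1"] by simp
    moreover have "(LINT x|?L. (a x * g (?u x) - f x) * ?v x)
        = (LINT x|?L. a x * g (?u x) * ?v x) - (LINT x|?L. f x * ?v x)"
      using integrable_mult_bounded[OF ag v_m M(2)] integrable_mult_bounded[OF f(1) v_m M(2)]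
      by (simp add: left_diff_distrib)
    ultimately show ?thesis by simp
  qed
  have "weak_solution \<Omega> X B a g f U" unfolding weak_solution_def using U(1) ag EL by blast
  then show ?thesis using u_bd that by blast
qed

end

section \<open>Existence, uniqueness and the bound\<close>

theorem theorem3p1:
  fixes \<Omega> :: "(real^'n) set"
    and X :: "'m::finite \<Rightarrow> real^'n \<Rightarrow> real^'n"
    and B :: "real^'n \<Rightarrow> real^'n^'n"
    and a f :: "real^'n \<Rightarrow> real"
    and g :: "real \<Rightarrow> real"
    and Q :: real
  assumes "CARD('n) \<ge> 2"
    and "open \<Omega>" and "connected \<Omega>" and "\<Omega> \<noteq> {}" and "bounded \<Omega>"
    and "\<And>j k. locally_lipschitz (\<lambda>x. X j x $ k)"
    and "\<And>i j. (\<lambda>x. B x $ i $ j) \<in> borel_measurable lebesgue"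
    and "\<And>x i j. B x $ i $ j = B x $ j $ i"
    and "X_elliptic \<Omega> X B"
    and "assumption_S \<Omega> X"
    and "integrable (lebesgue_on \<Omega>) a"
    and "AE x in lebesgue_on \<Omega>. a x \<ge> 0"
    and "integrable (lebesgue_on \<Omega>) f"
    and "continuous_on UNIV g"
    and "\<And>s. g (- s) = - g s"
    and "strict_mono g"
    and "0 < Q" and "ereal Q < Lim at_top (\<lambda>s. ereal (g s))"
    and "AE x in lebesgue_on \<Omega>. \<bar>f x\<bar> \<le> Q * a x"
  shows "(\<exists>!U. weak_solution \<Omega> X B a g f U \<and> in_Linf \<Omega> (fun_of \<Omega> U)) \<and>
    (\<forall>U. weak_solution \<Omega> X B a g f U \<and> in_Linf \<Omega> (fun_of \<Omega> U) \<longrightarrow>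
       Linf_norm \<Omega> (fun_of \<Omega> U) \<le> ereal (inv g Q))"
proof -
  interpret X_elliptic_operator \<Omega> X B
    by unfold_locales (fact assms)+
  have mono: "mono g" using assms(16) by (rule strict_mono_mono)
  have g0: "g 0 = 0" using assms(15)[of 0] by simp
  obtain k where k: "0 < k" "g k = Q"
    by (rule level_attained[OF assms(14) mono g0 assms(17,18)]) (rule that)
  have inv: "inv g Q = k"
    using inv_f_f[OF strict_mono_imp_inj_on[OF assms(16)], of k] k(2) by simp
  have gk: "g (- k) = - Q" using assms(15)[of k] k(2) by simp
  obtain U where U: "weak_solution \<Omega> X B a g f U" "AE x in lebesgue_on \<Omega>. \<bar>fun_of \<Omega> U x\<bar> \<le> k"
    by (rule weak_solution_exists[OF assms(11,12,13,19,14) mono g0 k(2) gk less_imp_le[OF k(1)]]) (rule that)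
  have "fun_of \<Omega> U \<in> borel_measurable (lebesgue_on \<Omega>)"
    using U(1) fun_of_represents(1) by (simp add: weak_solution_def borel_measurable_integrable)
  note bound = AE_bounded_Linf[OF this U(2)]
  have unique: "V = U" if V: "weak_solution \<Omega> X B a g f V" "in_Linf \<Omega> (fun_of \<Omega> V)" for V
  proof -
    obtain M where M: "AE x in lebesgue_on \<Omega>. \<bar>fun_of \<Omega> V x\<bar> \<le> M"
      by (rule in_Linf_AE_bounded[OF V(2)]) (rule that)
    have "AE x in lebesgue_on \<Omega>. \<bar>fun_of \<Omega> V x\<bar> \<le> max M k" using M by eventually_elim simp
    moreover have "AE x in lebesgue_on \<Omega>. \<bar>fun_of \<Omega> U x\<bar> \<le> max M k" using U(2) by eventually_elim simp
    ultimately show ?thesis using weak_solution_unique[OF assms(12) mono V(1) _ U(1)] by blast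
  qed
  show ?thesis
    unfolding inv
  proof (intro conjI allI impI)
    show "\<exists>!U. weak_solution \<Omega> X B a g f U \<and> in_Linf \<Omega> (fun_of \<Omega> U)"
      using U(1) bound(1) unique by blast
    show "Linf_norm \<Omega> (fun_of \<Omega> V) \<le> ereal k"
      if "weak_solution \<Omega> X B a g f V \<and> in_Linf \<Omega> (fun_of \<Omega> V)" for V
      using that unique[of V] bound(2) by simp
  qed
qed

end
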